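(* The homomorphism threshold of the family $\{C_3, C_5\}$ equals $1/5$, i.e. $\delta_{\hom}(\{C_3,C_5\}) = 1/5$.
   Context: $C_\ell$ denotes the cycle of length $\ell$. A graph is $\mathcal{H}$-free if it contains no member of $\mathcal{H}$ as a (not necessarily induced) subgraph. A graph $G$ is homomorphic to a graph $H$ if there is a map $f:V(G)\to V(H)$ with $f(u)f(v)\in E(H)$ whenever $uv\in E(G)$. For a family of graphs $\mathcal{H}$, the homomorphism threshold $\delta_{\hom}(\mathcal{H})$ is the infimum of all $d\in[0,1]$ for which there exists a constant $C=C(\mathcal{H},d)$ such that every $\mathcal{H}$-free graph $G$ with minimum degree at least $d|V(G)|$ is homomorphic to some $\mathcal{H}$-free graph on at most $C$ vertices (with $C$ independent of $|V(G)|$). *)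

theory Defs
  imports Complex_Main "Graph_Theory.Pair_Digraph"
begin

text \<open>
  Finite simple graphs are rendered by the locale predicate \<^const>\<open>pair_graph\<close>: finite vertex set,
  symmetric and loop-free arc relation, so that every edge \<open>uv\<close> is present as the two arcs
  \<open>(u, v)\<close> and \<open>(v, u)\<close>. The degree of a vertex is therefore its out-degree.
\<close>

definition graph_hom :: "('a \<Rightarrow> 'b) \<Rightarrow> 'a pair_pre_digraph \<Rightarrow> 'b pair_pre_digraph \<Rightarrow> bool" where
  "graph_hom f G H \<longleftrightarrow>
     (\<forall>v \<in> pverts G. f v \<in> pverts H) \<and> (\<forall>(u, v) \<in> parcs G. (f u, f v) \<in> parcs H)"

definition homomorphic_to :: "'a pair_pre_digraph \<Rightarrow> 'b pair_pre_digraph \<Rightarrow> bool" where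
  "homomorphic_to G H \<longleftrightarrow> (\<exists>f. graph_hom f G H)"

text \<open>Not necessarily induced copies of \<open>F\<close> in \<open>G\<close>: injectivity is only required on the vertices of \<open>F\<close>.\<close>

definition contains_subgraph :: "'a pair_pre_digraph \<Rightarrow> 'b pair_pre_digraph \<Rightarrow> bool" where
  "contains_subgraph G F \<longleftrightarrow> (\<exists>f. graph_hom f F G \<and> inj_on f (pverts F))"

definition family_free :: "'b pair_pre_digraph set \<Rightarrow> 'a pair_pre_digraph \<Rightarrow> bool" where
  "family_free \<H> G \<longleftrightarrow> (\<forall>F \<in> \<H>. \<not> contains_subgraph G F)"

text \<open>Only meaningful for graphs with at least one vertex.\<close>

definition min_degree :: "'a pair_pre_digraph \<Rightarrow> nat" where
  "min_degree G = Min (out_degree (with_proj G) ` pverts G)"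

text \<open>For \<open>l \<ge> 3\<close> this is the cycle of length \<open>l\<close>.\<close>

definition cycle_graph :: "nat \<Rightarrow> nat pair_pre_digraph" where
  "cycle_graph l =
     \<lparr> pverts = {..<l},
       parcs = {(i, j). i < l \<and> j < l \<and> (j = (i + 1) mod l \<or> i = (j + 1) mod l)} \<rparr>"

lemma pair_graph_cycle_graph:
  assumes "l \<ge> 3"
  shows "pair_graph (cycle_graph l)"
proof
  show "finite (parcs (cycle_graph l))"
    by (rule finite_subset[of _ "{..<l} \<times> {..<l}"]) (auto simp: cycle_graph_def)
  show "fst e \<noteq> snd e" if "e \<in> parcs (cycle_graph l)" for e
    using that assms by (auto simp: cycle_graph_def mod_Suc split: if_splits)
  show "symmetric (with_proj (cycle_graph l))"
    by (auto simp: symmetric_def sym_def cycle_graph_def)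
qed (auto simp: cycle_graph_def)

text \<open>
  Since the definition quantifies over all finite graphs, a fixed vertex type is needed. Vertices are
  natural numbers; up to isomorphism this covers every finite graph.
\<close>

definition hom_bounded :: "nat pair_pre_digraph set \<Rightarrow> real \<Rightarrow> bool" where
  "hom_bounded \<H> d \<longleftrightarrow>
     (\<exists>C :: nat. \<forall>G :: nat pair_pre_digraph.
        pair_graph G \<and> pverts G \<noteq> {} \<and> family_free \<H> G \<and>
        d * real (card (pverts G)) \<le> real (min_degree G) \<longrightarrow>
        (\<exists>H :: nat pair_pre_digraph.
           pair_graph H \<and> family_free \<H> H \<and> card (pverts H) \<le> C \<and> homomorphic_to G H))"

definition hom_threshold :: "nat pair_pre_digraph set \<Rightarrow> real" where
  "hom_threshold \<H> = Inf {d. 0 \<le> d \<and> d \<le> 1 \<and> hom_bounded \<H> d}"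

end

theory Submission
  imports Defs "HOL-Analysis.Convex" "HOL-Library.Countable" "HOL-Library.Nat_Bijection"
    "HOL-Number_Theory.Cong"
begin

text \<open>
  A loopless graph is free of triangles and pentagons iff it has no closed walk of length 5.

  Lower bound: join vertices \<open>w\<^sub>1, \<dots>, w\<^sub>n\<close> pairwise by internally disjoint paths of length 5, so that no
  \<open>{C\<^sub>3, C\<^sub>5}\<close>-free homomorphic image identifies two of them. These paths run through five classes of
  vertices (the \<open>w\<^sub>i\<close> and the four kinds of inner vertices) arranged like a \<open>C\<^sub>5\<close>; cut this \<open>C\<^sub>5\<close> open
  opposite to the \<open>w\<^sub>i\<close> and place below it the blow-up of a path with five large classes, as the second
  side of a ladder. The only closed 5-walks of the ladder with the extra cut edge go round the top, and
  lifting one to the graph would need a path from some \<open>w\<^sub>i\<close> to itself. The large classes push the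
  minimum degree towards a fifth of the vertices.

  Upper bound: colour a vertex \<open>v\<close> by a bounded approximation, in mean square, of its codegree function
  \<open>y \<mapsto> |N(v) \<inter> N(y)|\<close>, and refine this 16 times by the set of colours of the neighbours. A closed
  5-walk in the quotient lifts to a walk \<open>w\<^sub>0, \<dots>, w\<^sub>1\<^sub>6\<close> in \<open>G\<close> along which the codegree functions are almost
  5-periodic. Hence there are few edges between \<open>N(w\<^sub>i)\<close> and \<open>N(w\<^sub>j)\<close> if \<open>i - j \<equiv> \<plusminus>2\<close>, and \<open>N(w\<^sub>i)\<close> and
  \<open>N(w\<^sub>j)\<close> are almost disjoint if \<open>i - j \<equiv> \<plusminus>1\<close> modulo 5. Five almost disjoint neighbourhoods of more
  than a fifth of the vertices each cannot exist, so some \<open>N(w\<^sub>a) \<inter> N(w\<^sub>a\<^sub>+\<^sub>2)\<close> is large; the neighbourhood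
  of a typical vertex \<open>y\<close> in it is almost disjoint from all \<open>N(w\<^sub>j)\<close> with \<open>j \<noteq> a + 1\<close> modulo 5. Combining such
  vertices \<open>y\<close> with suitable \<open>w\<^sub>j\<close> always leads to five almost disjoint neighbourhoods.
\<close>

section \<open>Closed walks of length 5\<close>

lemma pair_graphI:
  assumes "finite (pverts G)" "parcs G \<subseteq> pverts G \<times> pverts G"
    and "\<And>u v. (u, v) \<in> parcs G \<Longrightarrow> (v, u) \<in> parcs G"
    and "\<And>u. (u, u) \<notin> parcs G"
  shows "pair_graph G"
proof
  show "finite (parcs G)" using assms(1,2) by (meson finite_SigmaI finite_subset)
  show "fst e \<noteq> snd e" if "e \<in> parcs G" for e
    using that assms(4) by (cases e) auto
  show "symmetric (with_proj G)"
    using assms(3) by (auto simp: symmetric_def sym_def)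
qed (use assms in auto)

text \<open>Vertices may repeat, so that, unlike copies of a subgraph, these walks are preserved by
  every homomorphism. In particular a loop violates the property.\<close>

definition closed_walk5_free :: "'a rel \<Rightarrow> bool" where
  "closed_walk5_free R \<longleftrightarrow> \<not> (\<exists>a b c d e. (a, b) \<in> R \<and> (b, c) \<in> R \<and> (c, d) \<in> R \<and> (d, e) \<in> R \<and> (e, a) \<in> R)"

lemma closed_walk5_freeD:
  "\<lbrakk>closed_walk5_free R; (a, b) \<in> R; (b, c) \<in> R; (c, d) \<in> R; (d, e) \<in> R; (e, a) \<in> R\<rbrakk> \<Longrightarrow> False"
  unfolding closed_walk5_free_def by blast

text \<open>A pentagon is itself a closed 5-walk; a triangle becomes one by going round it once and
  then along one edge forth and back.\<close>

lemma closed_walk5_free_imp_family_free: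
  assumes free: "closed_walk5_free (parcs G)"
    and sym: "\<And>u v. (u, v) \<in> parcs G \<Longrightarrow> (v, u) \<in> parcs G"
  shows "family_free {cycle_graph 3, cycle_graph 5} G"
proof -
  have "\<not> contains_subgraph G (cycle_graph 3)"
  proof
    assume "contains_subgraph G (cycle_graph 3)"
    then obtain f where "graph_hom f (cycle_graph 3) G" by (auto simp: contains_subgraph_def)
    then have f: "(f i, f j) \<in> parcs G" if "(i, j) \<in> parcs (cycle_graph 3)" for i j
      using that unfolding graph_hom_def by blast
    have "(f 0, f 1) \<in> parcs G" "(f 1, f 2) \<in> parcs G" "(f 2, f 0) \<in> parcs G"
      by (rule f; simp add: cycle_graph_def)+
    then show False using closed_walk5_freeD[OF free, of "f 0" "f 1" "f 2" "f 0" "f 1"] sym by blast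
  qed
  moreover have "\<not> contains_subgraph G (cycle_graph 5)"
  proof
    assume "contains_subgraph G (cycle_graph 5)"
    then obtain f where "graph_hom f (cycle_graph 5) G" by (auto simp: contains_subgraph_def)
    then have f: "(f i, f j) \<in> parcs G" if "(i, j) \<in> parcs (cycle_graph 5)" for i j
      using that unfolding graph_hom_def by blast
    have "(f 0, f 1) \<in> parcs G" "(f 1, f 2) \<in> parcs G" "(f 2, f 3) \<in> parcs G"
      "(f 3, f 4) \<in> parcs G" "(f 4, f 0) \<in> parcs G"
      by (rule f; simp add: cycle_graph_def)+
    then show False using closed_walk5_freeD[OF free] by blast
  qed
  ultimately show ?thesis by (simp add: family_free_def)
qed

text \<open>If two vertices at distance two along a closed 5-walk coincide, the other three edges
  form a triangle. Otherwise, as there are no loops, the five vertices are distinct and form a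
  pentagon.\<close>

lemma family_free_imp_closed_walk5_free:
  assumes "pair_graph G" and free: "family_free {cycle_graph 3, cycle_graph 5} G"
  shows "closed_walk5_free (parcs G)"
proof -
  interpret pair_graph G by fact
  note sym = arcs_symmetric
  have ne: "u \<noteq> v" if "(u, v) \<in> parcs G" for u v using pair_no_loops[OF that] by simp
  have contains: "contains_subgraph G (cycle_graph l)"
    if "length xs = l" "distinct xs" "\<And>i. i < l \<Longrightarrow> (xs ! i, xs ! ((i + 1) mod l)) \<in> parcs G" for xs l
    unfolding contains_subgraph_def graph_hom_def
  proof (intro exI[of _ "(!) xs"] conjI ballI)
    show "xs ! v \<in> pverts G" if "v \<in> pverts (cycle_graph l)" for v
      using that \<open>\<And>i. i < l \<Longrightarrow> _\<close>[of v] in_arcsD1 by (auto simp: cycle_graph_def)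
    show "case e of (u, v) \<Rightarrow> (xs ! u, xs ! v) \<in> parcs G" if "e \<in> parcs (cycle_graph l)" for e
      using that \<open>\<And>i. i < l \<Longrightarrow> _\<close> sym by (auto simp: cycle_graph_def)
    show "inj_on ((!) xs) (pverts (cycle_graph l))"
      using that(1,2) by (auto simp: cycle_graph_def inj_on_def nth_eq_iff_index_eq)
  qed
  have triangle: False if "(x, y) \<in> parcs G" "(y, z) \<in> parcs G" "(z, x) \<in> parcs G" for x y z
  proof -
    have "contains_subgraph G (cycle_graph 3)"
    proof (rule contains[of "[x, y, z]"])
      show "distinct [x, y, z]" using that[THEN ne] by simp
      show "([x, y, z] ! i, [x, y, z] ! ((i + 1) mod 3)) \<in> parcs G" if i: "i < 3" for i
      proof -
        consider "i = 0" | "i = 1" | "i = 2" using i by linarith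
        then show ?thesis using \<open>(x, y) \<in> _\<close> \<open>(y, z) \<in> _\<close> \<open>(z, x) \<in> _\<close> by cases simp_all
      qed
    qed simp
    then show False using free by (simp add: family_free_def)
  qed
  show ?thesis
    unfolding closed_walk5_free_def
  proof (intro notI, elim exE conjE)
    fix a b c d e
    assume w: "(a, b) \<in> parcs G" "(b, c) \<in> parcs G" "(c, d) \<in> parcs G" "(d, e) \<in> parcs G" "(e, a) \<in> parcs G"
    have "a \<noteq> c" "a \<noteq> d" "b \<noteq> d" "b \<noteq> e" "c \<noteq> e"
      using triangle[of c d e] triangle[of a b c] triangle[of d e a] triangle[of b c d] triangle[of e a b] w
      by auto
    then have distinct: "distinct [a, b, c, d, e]" using w[THEN ne] by auto
    have "contains_subgraph G (cycle_graph 5)"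
    proof (rule contains[OF _ distinct])
      show "([a, b, c, d, e] ! i, [a, b, c, d, e] ! ((i + 1) mod 5)) \<in> parcs G" if i: "i < 5" for i
      proof -
        consider "i = 0" | "i = 1" | "i = 2" | "i = 3" | "i = 4" using i by linarith
        then show ?thesis using w by cases simp_all
      qed
    qed simp
    then show False using free by (simp add: family_free_def)
  qed
qed

lemma out_degree_eq: "out_degree (with_proj G) v = card {u. (v, u) \<in> parcs G}"
proof -
  have "out_arcs (with_proj G) v = Pair v ` {u. (v, u) \<in> parcs G}"
    by (auto simp: out_arcs_def)
  then show ?thesis by (simp add: out_degree_def card_image inj_on_def)
qed

section \<open>Codegree functions\<close>

text \<open>The sample is chosen greedily: the mean over the next point kills the cross term of the square.\<close>

lemma small_second_moment_sample:
  fixes g :: "'i \<Rightarrow> 'a \<Rightarrow> real"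
  assumes "finite V" "V \<noteq> {}" "finite I"
    and mean: "\<And>i. i \<in> I \<Longrightarrow> (\<Sum>s\<in>V. g i s) = 0"
    and bound: "\<And>i s. i \<in> I \<Longrightarrow> s \<in> V \<Longrightarrow> \<bar>g i s\<bar> \<le> 1"
  shows "\<exists>S. length S = m \<and> set S \<subseteq> V \<and> (\<Sum>i\<in>I. (\<Sum>s\<leftarrow>S. g i s)\<^sup>2) \<le> real m * real (card I)"
proof (induction m)
  case 0
  then show ?case by simp
next
  case (Suc m)
  then obtain S where S: "length S = m" "set S \<subseteq> V"
    "(\<Sum>i\<in>I. (\<Sum>s\<leftarrow>S. g i s)\<^sup>2) \<le> real m * real (card I)" by blast
  define P where "P i = (\<Sum>s\<leftarrow>S. g i s)" for i
  have "(\<Sum>s\<in>V. \<Sum>i\<in>I. (g i s + P i)\<^sup>2) = (\<Sum>i\<in>I. \<Sum>s\<in>V. (g i s + P i)\<^sup>2)"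
    by (rule sum.swap)
  also have "\<dots> \<le> (\<Sum>i\<in>I. real (card V) * (1 + (P i)\<^sup>2))"
  proof (rule sum_mono)
    fix i assume i: "i \<in> I"
    have "(\<Sum>s\<in>V. (g i s + P i)\<^sup>2)
        = (\<Sum>s\<in>V. (g i s)\<^sup>2) + 2 * P i * (\<Sum>s\<in>V. g i s) + real (card V) * (P i)\<^sup>2"
      by (simp add: power2_sum sum.distrib sum_distrib_left mult_ac)
    also have "\<dots> \<le> (\<Sum>s\<in>V. 1) + real (card V) * (P i)\<^sup>2"
      using mean[OF i] sum_mono[of V "\<lambda>s. (g i s)\<^sup>2" "\<lambda>_. 1"] bound[OF i]
      by (simp add: abs_square_le_1)
    finally show "(\<Sum>s\<in>V. (g i s + P i)\<^sup>2) \<le> real (card V) * (1 + (P i)\<^sup>2)"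
      by (simp add: algebra_simps)
  qed
  also have "\<dots> = real (card V) * (real (card I) + (\<Sum>i\<in>I. (P i)\<^sup>2))"
    by (simp add: sum.distrib flip: sum_distrib_left)
  also have "\<dots> \<le> real (card V) * (real (Suc m) * real (card I))"
    using S(3) by (intro mult_left_mono) (auto simp: P_def algebra_simps)
  finally have le: "(\<Sum>s\<in>V. \<Sum>i\<in>I. (g i s + P i)\<^sup>2) \<le> (\<Sum>s\<in>V. real (Suc m) * real (card I))"
    by simp
  have "\<exists>s\<in>V. (\<Sum>i\<in>I. (g i s + P i)\<^sup>2) \<le> real (Suc m) * real (card I)"
  proof (rule ccontr)
    assume "\<not> ?thesis"
    then have "(\<Sum>s\<in>V. real (Suc m) * real (card I)) < (\<Sum>s\<in>V. \<Sum>i\<in>I. (g i s + P i)\<^sup>2)"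
      using assms by (intro sum_strict_mono) (auto simp: not_le)
    then show False using le by simp
  qed
  then obtain s where "s \<in> V" "(\<Sum>i\<in>I. (g i s + P i)\<^sup>2) \<le> real (Suc m) * real (card I)" by blast
  then show ?case
    using S by (intro exI[of _ "s # S"]) (simp add: P_def)
qed

definition codeg :: "('a \<Rightarrow> 'a set) \<Rightarrow> 'a \<Rightarrow> 'a \<Rightarrow> real" where
  "codeg N u v = real (card (N u \<inter> N v))"

text \<open>The squared L2 distance of two codegree functions. Its natural scale is
  \<open>card V ^ 3\<close>: one term per vertex, each at most \<open>card V ^ 2\<close> when
  neighbourhoods lie in \<open>V\<close>.\<close>

definition codist :: "'a set \<Rightarrow> ('a \<Rightarrow> 'a set) \<Rightarrow> 'a \<Rightarrow> 'a \<Rightarrow> real" where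
  "codist V N u v = (\<Sum>y\<in>V. (codeg N u y - codeg N v y)\<^sup>2)"

lemma codist_commute: "codist V N u v = codist V N v u"
  by (simp add: codist_def power2_commute)

lemma codist_triangle: "codist V N u v \<le> 2 * codist V N u p + 2 * codist V N p v"
proof -
  have "(a - b)\<^sup>2 \<le> 2 * (a - c)\<^sup>2 + 2 * (c - b)\<^sup>2" for a b c :: real
  proof -
    have "2 * (a - c)\<^sup>2 + 2 * (c - b)\<^sup>2 - (a - b)\<^sup>2 = (a + b - 2 * c)\<^sup>2"
      by (simp add: power2_eq_square algebra_simps)
    then show ?thesis by (metis diff_ge_0_iff_ge zero_le_power2)
  qed
  then show ?thesis
    unfolding codist_def sum_distrib_left sum.distrib[symmetric] by (intro sum_mono) auto
qed

text \<open>
  Most vertices of \<open>P\<close> have codegrees that are well estimated from the trace of their neighbourhood on a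
  sample of size \<open>m\<close>, and there are only \<open>2 ^ m\<close> traces.
\<close>

lemma codist_packing:
  fixes N :: "'a \<Rightarrow> 'a set"
  assumes fin: "finite V" and ne: "V \<noteq> {}" and NV: "\<And>v. v \<in> V \<Longrightarrow> N v \<subseteq> V"
    and PV: "P \<subseteq> V" and m: "m > 0"
    and sep: "\<And>u v. u \<in> P \<Longrightarrow> v \<in> P \<Longrightarrow> u \<noteq> v \<Longrightarrow> codist V N u v > 8 * real (card V) ^ 3 / real m"
  shows "card P \<le> 2 * 2 ^ m"
proof (rule ccontr)
  assume "\<not> ?thesis"
  then have big: "card P > 2 * 2 ^ m" by simp
  have finP: "finite P" using PV fin finite_subset by blast
  define n where "n = real (card V)"
  have n: "n > 0" using fin ne by (simp add: n_def card_gt_0_iff)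
  \<comment> \<open>The centred indicator of a common neighbour: its sum over a sample is the number
    of hits minus the expected number \<open>m * codeg N u y / n\<close>.\<close>
  define g where "g = (\<lambda>(u, y) s. of_bool (s \<in> N u \<inter> N y) - codeg N u y / n)"
  have cod: "0 \<le> codeg N u y" "codeg N u y \<le> n" if "u \<in> V" for u y
    using NV[OF that] fin by (auto simp: codeg_def n_def intro!: card_mono)
  have "\<exists>S. length S = m \<and> set S \<subseteq> V \<and>
     (\<Sum>i\<in>P \<times> V. (\<Sum>s\<leftarrow>S. g i s)\<^sup>2) \<le> real m * real (card (P \<times> V))"
  proof (rule small_second_moment_sample)
    fix i assume "i \<in> P \<times> V"
    then obtain u y where i: "i = (u, y)" "u \<in> V" "y \<in> V" using PV by auto
    have "V \<inter> (N u \<inter> N y) = N u \<inter> N y" using NV i by auto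
    then show "(\<Sum>s\<in>V. g i s) = 0" 
      using n fin ne by (simp add: i g_def sum_subtractf of_bool_def sum.If_cases codeg_def n_def
          flip: Int_def Collect_conj_eq)
    have "codeg N u y / n \<le> 1" "0 \<le> codeg N u y / n" using cod[OF i(2)] n by auto
    then show "\<bar>g i s\<bar> \<le> 1" for s by (auto simp: i g_def)
  qed (use fin ne finP in auto)
  then obtain S where S: "length S = m" "set S \<subseteq> V"
    and le: "(\<Sum>i\<in>P \<times> V. (\<Sum>s\<leftarrow>S. g i s)\<^sup>2) \<le> real m * real (card (P \<times> V))" by blast
  define err where "err u = (\<Sum>y\<in>V. (\<Sum>s\<leftarrow>S. g (u, y) s)\<^sup>2)" for u
  have err0: "err u \<ge> 0" for u by (simp add: err_def sum_nonneg)
  have tot: "(\<Sum>u\<in>P. err u) \<le> real m * real (card P) * n"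
    using le by (simp add: err_def sum.cartesian_product card_cartesian_product n_def mult_ac)
  \<comment> \<open>Markov: the average of \<open>err\<close> over \<open>P\<close> is at most
    \<open>m * n\<close>, so at least half of \<open>P\<close> has at most twice that error.\<close>
  define Q where "Q = {u \<in> P. err u \<le> 2 * real m * n}"
  have "real (card (P - Q)) * (2 * real m * n) = (\<Sum>u\<in>P - Q. 2 * real m * n)" by simp
  also have "\<dots> \<le> (\<Sum>u\<in>P - Q. err u)" by (intro sum_mono) (auto simp: Q_def)
  also have "\<dots> \<le> (\<Sum>u\<in>P. err u)" using finP err0 by (intro sum_mono2) auto
  also note tot
  finally have "2 * real (card (P - Q)) * (real m * n) \<le> real (card P) * (real m * n)"
    by (simp add: mult_ac)
  then have "2 * real (card (P - Q)) \<le> real (card P)" using m n by simp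
  moreover have "card P = card (P - Q) + card Q"
    using finP by (metis Q_def card_Diff_subset card_mono finite_subset le_add_diff_inverse2 mem_Collect_eq subsetI)
  ultimately have Q: "card Q > 2 ^ m" using big by linarith
  \<comment> \<open>Pigeonhole: \<open>Q\<close> has more than \<open>2 ^ m\<close> members, but
    there are only \<open>2 ^ m\<close> traces.\<close>
  define trace where "trace u = {k \<in> {..<m}. S ! k \<in> N u}" for u
  have "\<not> inj_on trace Q"
  proof
    assume "inj_on trace Q"
    then have "card Q \<le> card (Pow {..<m})" by (rule card_inj_on_le) (auto simp: trace_def)
    then show False using Q by (simp add: card_Pow)
  qed
  then obtain u v where uv: "u \<in> Q" "v \<in> Q" "u \<noteq> v"
    and tr: "trace u = trace v" by (auto simp: inj_on_def)
  have same: "s \<in> N u \<longleftrightarrow> s \<in> N v" if s: "s \<in> set S" for s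
  proof -
    obtain k where k: "k < length S" "S ! k = s" using s unfolding in_set_conv_nth by blast
    then have "k \<in> trace x \<longleftrightarrow> s \<in> N x" for x
      using S(1) by (simp add: trace_def)
    then show ?thesis using tr by blast
  qed
  \<comment> \<open>Equal traces mean equal numbers of hits, so the two errors differ only by the
    expected numbers.\<close>
  have diff: "(\<Sum>s\<leftarrow>S. g (u, y) s) - (\<Sum>s\<leftarrow>S. g (v, y) s) = - (real m / n * (codeg N u y - codeg N v y))" for y
  proof -
    have "(\<Sum>s\<leftarrow>S. g (u, y) s) - (\<Sum>s\<leftarrow>S. g (v, y) s) = (\<Sum>s\<leftarrow>S. g (u, y) s - g (v, y) s)"
      by (simp add: sum_list_subtractf)
    also have "\<dots> = (\<Sum>s\<leftarrow>S. codeg N v y / n - codeg N u y / n)"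
      by (rule arg_cong[where f = sum_list], rule map_cong) (use same in \<open>auto simp: g_def\<close>)
    also have "\<dots> = - (real m / n * (codeg N u y - codeg N v y))"
      by (simp add: sum_list_triv S(1) algebra_simps diff_divide_distrib)
    finally show ?thesis .
  qed
  have sq: "(a - b)\<^sup>2 \<le> 2 * a\<^sup>2 + 2 * b\<^sup>2" for a b :: real
  proof -
    have "2 * a\<^sup>2 + 2 * b\<^sup>2 - (a - b)\<^sup>2 = (a + b)\<^sup>2" by (simp add: power2_eq_square algebra_simps)
    then show ?thesis by (metis diff_ge_0_iff_ge zero_le_power2)
  qed
  have "(real m / n)\<^sup>2 * codist V N u v
      = (\<Sum>y\<in>V. ((\<Sum>s\<leftarrow>S. g (u, y) s) - (\<Sum>s\<leftarrow>S. g (v, y) s))\<^sup>2)"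
    by (simp add: diff codist_def sum_distrib_left power_mult_distrib power_divide)
  also have "\<dots> \<le> 2 * err u + 2 * err v"
    unfolding err_def sum_distrib_left sum.distrib[symmetric] by (intro sum_mono sq)
  also have "\<dots> \<le> 8 * real m * n" using uv by (simp add: Q_def)
  finally have "(real m)\<^sup>2 / n\<^sup>2 * codist V N u v \<le> 8 * real m * n" by (simp add: power_divide)
  then have "codist V N u v \<le> 8 * n ^ 3 / real m"
    using m n by (simp add: field_simps power2_eq_square power3_eq_cube)
  with sep[of u v] uv show False by (auto simp: Q_def n_def)
qed

text \<open>A largest family of pairwise far vertices has bounded size by
  \<open>codist_packing\<close>, and every vertex is near one of its members. Colouring by such a
  centre uses a number of colours that depends on \<eta> alone.\<close>

lemma codist_centers:
  fixes \<eta> :: real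
  assumes "\<eta> > 0"
  shows "\<exists>K. \<forall>V (N :: 'a \<Rightarrow> 'a set). finite V \<longrightarrow> V \<noteq> {} \<longrightarrow> (\<forall>v\<in>V. N v \<subseteq> V) \<longrightarrow>
    (\<exists>t. \<forall>u\<in>V. t u < (K :: nat) \<and> (\<forall>v\<in>V. t u = t v \<longrightarrow> codist V N u v \<le> \<eta> * real (card V) ^ 3))"
proof -
  \<comment> \<open>Large enough to bring the packing threshold 8 / m down to \<eta> / 4.\<close>
  define m where "m = Suc (nat \<lceil>32 / \<eta>\<rceil>)"
  have m: "m > 0" "32 / \<eta> \<le> real m" unfolding m_def by linarith+
  have small: "8 * real k ^ 3 / real m \<le> \<eta> / 4 * real k ^ 3" for k :: nat
  proof -
    have "8 / real m \<le> \<eta> / 4" using m assms by (simp add: field_simps)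
    from mult_right_mono[OF this, of "real k ^ 3"] show ?thesis by simp
  qed
  show ?thesis
  proof (intro exI[of _ "Suc (2 * 2 ^ m)"] allI impI)
    fix V :: "'a set" and N :: "'a \<Rightarrow> 'a set"
    assume V: "finite V" "V \<noteq> {}" "\<forall>v\<in>V. N v \<subseteq> V"
    \<comment> \<open>A quarter of \<eta>, because passing through a common centre costs twice the
      distance on either side.\<close>
    define far where "far u v \<longleftrightarrow> codist V N u v > \<eta> / 4 * real (card V) ^ 3" for u v
    define good where "good P \<longleftrightarrow> P \<subseteq> V \<and> (\<forall>u\<in>P. \<forall>v\<in>P. u \<noteq> v \<longrightarrow> far u v)" for P
    have bd: "card P \<le> 2 * 2 ^ m" if "good P" for P
    proof (rule codist_packing)
      fix u v assume "u \<in> P" "v \<in> P" "u \<noteq> v"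
      then have "far u v" using that by (auto simp: good_def)
      then show "codist V N u v > 8 * real (card V) ^ 3 / real m"
        unfolding far_def using small[of "card V"] by linarith
    qed (use V m that in \<open>auto simp: good_def\<close>)
    have "good {}" by (simp add: good_def)
    then have "\<exists>P. good P \<and> (\<forall>Q. good Q \<longrightarrow> card Q \<le> card P)"
      by (rule ex_has_greatest_nat[where b = "Suc (2 * 2 ^ m)"]) (use bd in \<open>simp add: less_Suc_eq_le\<close>)
    then obtain P where P: "good P" "\<And>Q. good Q \<Longrightarrow> card Q \<le> card P" by blast
    have finP: "finite P" using P(1) V finite_subset by (auto simp: good_def)
    have close: "\<exists>p\<in>P. \<not> far u p" if "u \<in> V" for u
    proof (rule ccontr)
      assume *: "\<not> ?thesis"
      have "\<not> far u u" using assms by (simp add: far_def codist_def not_less)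
      then have "u \<notin> P" using * by auto
      moreover have "good (insert u P)"
        using P(1) * that codist_commute[of V N] by (auto simp: good_def far_def)
      ultimately show False using P(2)[of "insert u P"] finP by simp
    qed
    then obtain c where c: "\<And>u. u \<in> V \<Longrightarrow> c u \<in> P" "\<And>u. u \<in> V \<Longrightarrow> \<not> far u (c u)" by metis
    obtain h where h: "bij_betw h P {0..<card P}"
      using ex_bij_betw_finite_nat[OF finP] by blast
    show "\<exists>t. \<forall>u\<in>V. t u < Suc (2 * 2 ^ m) \<and>
      (\<forall>v\<in>V. t u = t v \<longrightarrow> codist V N u v \<le> \<eta> * real (card V) ^ 3)"
    proof (intro exI[of _ "h \<circ> c"] ballI conjI impI)
      fix u assume u: "u \<in> V"
      have "h (c u) < card P" using h c(1)[OF u] by (auto simp: bij_betw_def)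
      then show "(h \<circ> c) u < Suc (2 * 2 ^ m)" using bd[OF P(1)] by simp
      fix v assume v: "v \<in> V" and "(h \<circ> c) u = (h \<circ> c) v"
      then have "c u = c v" using h c(1) u by (auto simp: bij_betw_def inj_on_def)
      then show "codist V N u v \<le> \<eta> * real (card V) ^ 3"
        using c(2)[OF u] c(2)[OF v] codist_triangle[of V N u v "c u"] codist_commute[of V N v "c u"]
        by (simp add: far_def)
    qed
  qed
qed

section \<open>Iterated colour refinement\<close>

text \<open>The old colour and the set of colours of the neighbours are coded into one number, so
  that all rounds have colours of the same type.\<close>

fun walk_type :: "('a \<Rightarrow> 'a set) \<Rightarrow> ('a \<Rightarrow> nat) \<Rightarrow> nat \<Rightarrow> 'a \<Rightarrow> nat" where
  "walk_type N t 0 v = t v"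
| "walk_type N t (Suc k) v = prod_encode (walk_type N t k v, set_encode (walk_type N t k ` N v))"

text \<open>The bound is uniform in the graph and the initial colouring: \<open>B\<close> colours
  yield at most \<open>B * 2 ^ B\<close> codes in the next round.\<close>

lemma walk_type_bounded:
  "\<exists>B. \<forall>V (N :: 'a \<Rightarrow> 'a set) t. (\<forall>v\<in>V. N v \<subseteq> V) \<longrightarrow> (\<forall>v\<in>V. t v < K) \<longrightarrow>
     (\<forall>v\<in>V. walk_type N t k v < (B :: nat))"
proof (induction k)
  case 0
  then show ?case by auto
next
  case (Suc k)
  then obtain B where "\<forall>V (N :: 'a \<Rightarrow> 'a set) t. (\<forall>v\<in>V. N v \<subseteq> V) \<longrightarrow> (\<forall>v\<in>V. t v < K) \<longrightarrow>
     (\<forall>v\<in>V. walk_type N t k v < B)" ..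
  then have B: "walk_type N t k v < B"
    if "\<forall>v\<in>V. N v \<subseteq> V" "\<forall>v\<in>V. t v < K" "v \<in> V" for V N v and t :: "'a \<Rightarrow> nat"
    using that by (elim allE[of _ V] allE[of _ N] allE[of _ t]) simp
  define X where "X = prod_encode ` ({..<B} \<times> set_encode ` Pow {..<B})"
  have fin: "finite X" by (simp add: X_def)
  have "walk_type N t (Suc k) v < Suc (Max X)"
    if "\<forall>v\<in>V. N v \<subseteq> V" "\<forall>v\<in>V. t v < K" "v \<in> V" for V N v and t :: "'a \<Rightarrow> nat"
  proof -
    have "walk_type N t k ` N v \<subseteq> {..<B}" using B[OF that(1,2)] that by auto
    then have "walk_type N t (Suc k) v \<in> X" using B[OF that] by (auto simp: X_def)
    then show ?thesis using fin by (simp add: less_Suc_eq_le)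
  qed
  then show ?case by (intro exI[of _ "Suc (Max X)"] allI impI ballI)
qed

text \<open>\<open>set_encode\<close> is injective on finite sets only; hence the finiteness
  assumptions.\<close>

lemma walk_type_SucD:
  assumes "walk_type N t (Suc k) u = walk_type N t (Suc k) v" "finite (N u)" "finite (N v)"
  shows "walk_type N t k u = walk_type N t k v"
    and "p \<in> N u \<Longrightarrow> \<exists>q\<in>N v. walk_type N t k q = walk_type N t k p"
proof -
  have "set_encode (walk_type N t k ` N u) = set_encode (walk_type N t k ` N v)"
    and *: "walk_type N t k u = walk_type N t k v"
    using assms(1) by auto
  then have "walk_type N t k ` N u = walk_type N t k ` N v"
    using assms by (simp add: set_encode_eq)
  then show "p \<in> N u \<Longrightarrow> \<exists>q\<in>N v. walk_type N t k q = walk_type N t k p"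
    by (metis imageE imageI)
  show "walk_type N t k u = walk_type N t k v" by (fact *)
qed

lemma walk_type_antimono:
  assumes "walk_type N t k u = walk_type N t k v" "j \<le> k" "\<And>v. finite (N v)"
  shows "walk_type N t j u = walk_type N t j v"
  using assms(2,1)
proof (induction rule: dec_induct)
  case (step k)
  then show ?case using walk_type_SucD(1)[of N t k u v] assms(3) by blast
qed

text \<open>Each step of the lift spends one round of refinement: if \<open>w j\<close> looks like
  colour \<open>h j\<close> up to \<open>L - j\<close> rounds, it has a neighbour that looks like
  \<open>h (Suc j)\<close> up to one round less.\<close>

lemma lift_walk:
  assumes fin: "\<And>v. finite (N v)"
    and edge: "\<And>r. \<exists>u v. v \<in> N u \<and> walk_type N t L u = h r \<and> walk_type N t L v = h (Suc r)"
  shows "j \<le> L \<Longrightarrow> \<exists>w. (\<forall>i<j. w (Suc i) \<in> N (w i)) \<and>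
    (\<forall>i\<le>j. \<exists>x. walk_type N t L x = h i \<and> walk_type N t (L - i) (w i) = walk_type N t (L - i) x)"
proof (induction j)
  case 0
  obtain u where "walk_type N t L u = h 0" using edge[of 0] by blast
  then show ?case by (intro exI[of _ "\<lambda>_. u"]) auto
next
  case (Suc j)
  from Suc.IH[OF Suc_leD[OF Suc.prems]] obtain w where w: "\<forall>i<j. w (Suc i) \<in> N (w i)"
    "\<forall>i\<le>j. \<exists>x. walk_type N t L x = h i \<and> walk_type N t (L - i) (w i) = walk_type N t (L - i) x"
    by (elim exE conjE)
  obtain x where x: "walk_type N t L x = h j" "walk_type N t (L - j) (w j) = walk_type N t (L - j) x"
    using w(2) by blast
  obtain u v where uv: "v \<in> N u" "walk_type N t L u = h j" "walk_type N t L v = h (Suc j)"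
    using edge by blast
  have "walk_type N t (L - j) x = walk_type N t (L - j) u"
    by (rule walk_type_antimono[where k = L]) (use x uv fin in auto)
  then have "walk_type N t (Suc (L - Suc j)) u = walk_type N t (Suc (L - Suc j)) (w j)"
    using x Suc.prems by (simp add: Suc_diff_Suc)
  from walk_type_SucD(2)[OF this fin fin uv(1)] obtain q
    where q: "q \<in> N (w j)" "walk_type N t (L - Suc j) q = walk_type N t (L - Suc j) v" by blast
  define w' where "w' = w(Suc j := q)"
  have "w' (Suc i) \<in> N (w' i)" if "i < Suc j" for i
    using that w(1) q(1) by (auto simp: w'_def less_Suc_eq)
  moreover have "\<exists>x. walk_type N t L x = h i \<and> walk_type N t (L - i) (w' i) = walk_type N t (L - i) x"
    if "i \<le> Suc j" for i
    using that w(2) q(2) uv(3) by (auto simp: w'_def le_Suc_eq)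
  ultimately show ?case by blast
qed

section \<open>Almost periodic walks\<close>

text \<open>Bonferroni: the surplus 2 \<kappa> of each of the five sets pays for the ten pairwise
  intersections. These are strictly smaller than allowed, so the union would exceed
  \<open>V\<close>.\<close>

lemma no_five_large_sets:
  assumes "finite V"
    and sub: "A \<subseteq> V" "B \<subseteq> V" "C \<subseteq> V" "D \<subseteq> V" "E \<subseteq> V"
    and large: "\<And>X. X \<in> {A, B, C, D, E} \<Longrightarrow> (1 / 5 + 2 * \<kappa>) * real (card V) \<le> real (card X)"
    and pos: "\<kappa> * real (card V) > 0"
    and small: "real (card (A \<inter> B)) < \<kappa> * real (card V)" "real (card (A \<inter> C)) < \<kappa> * real (card V)"
      "real (card (A \<inter> D)) < \<kappa> * real (card V)" "real (card (A \<inter> E)) < \<kappa> * real (card V)"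
      "real (card (B \<inter> C)) < \<kappa> * real (card V)" "real (card (B \<inter> D)) < \<kappa> * real (card V)"
      "real (card (B \<inter> E)) < \<kappa> * real (card V)" "real (card (C \<inter> D)) < \<kappa> * real (card V)"
      "real (card (C \<inter> E)) < \<kappa> * real (card V)" "real (card (D \<inter> E)) < \<kappa> * real (card V)"
  shows False
proof -
  have fin: "finite A" "finite B" "finite C" "finite D" "finite E"
    using assms finite_subset by blast+
  have un: "real (card (X \<union> Y)) = real (card X) + real (card Y) - real (card (X \<inter> Y))"
    if "finite X" "finite Y" for X Y :: "'a set"
    using card_Un_Int[OF that] by simp
  have i: "real (card ((X \<union> Y) \<inter> Z)) \<le> real (card (X \<inter> Z)) + real (card (Y \<inter> Z))" for X Y Z :: "'a set"
    using card_Un_le[of "X \<inter> Z" "Y \<inter> Z"] by (simp add: Int_Un_distrib2 flip: of_nat_add)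
  have "real (card (A \<union> B \<union> C \<union> D \<union> E)) \<le> real (card V)"
    using assms by (intro of_nat_mono card_mono) auto
  moreover have "real (card V) / 5 + 2 * (\<kappa> * real (card V)) \<le> real (card X)" if "X \<in> {A, B, C, D, E}" for X
    using large[OF that] by (simp add: algebra_simps)
  from this[of A] this[of B] this[of C] this[of D] this[of E]
  have "real (card V) + 10 * (\<kappa> * real (card V))
      \<le> real (card A) + real (card B) + real (card C) + real (card D) + real (card E)" by simp
  moreover have "real (card (A \<union> B)) \<ge> real (card A) + real (card B) - \<kappa> * real (card V)"
    using un[of A B] fin small by simp
  moreover have "real (card (A \<union> B \<union> C)) \<ge> real (card (A \<union> B)) + real (card C) - 2 * (\<kappa> * real (card V))"
    using un[of "A \<union> B" C] i[of A B C] fin small by simp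
  moreover have "real (card (A \<union> B \<union> C \<union> D)) \<ge> real (card (A \<union> B \<union> C)) + real (card D) - 3 * (\<kappa> * real (card V))"
    using un[of "A \<union> B \<union> C" D] i[of "A \<union> B" C D] i[of A B D] fin small by simp
  moreover have "real (card (A \<union> B \<union> C \<union> D \<union> E)) > real (card (A \<union> B \<union> C \<union> D)) + real (card E) - 4 * (\<kappa> * real (card V))"
    using un[of "A \<union> B \<union> C \<union> D" E] i[of "A \<union> B \<union> C" D E] i[of "A \<union> B" C E] i[of A B E] fin small by simp
  ultimately show False by linarith
qed

text \<open>As \<open>g y * h y\<close> vanishes, \<open>f\<close> may be replaced by the small
  function \<open>f - g\<close> before Cauchy-Schwarz is applied. This turns an exact zero at one
  vertex of the walk into a small sum at another vertex of the same residue.\<close>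

lemma weighted_sum_diff_le:
  fixes f g h :: "'a \<Rightarrow> real"
  assumes "(\<Sum>y\<in>A. (f y - g y)\<^sup>2) \<le> a\<^sup>2" "(\<Sum>y\<in>A. (h y)\<^sup>2) \<le> b\<^sup>2" "a \<ge> 0" "b \<ge> 0"
    and "\<And>y. y \<in> A \<Longrightarrow> g y * h y = 0"
  shows "(\<Sum>y\<in>A. f y * h y) \<le> a * b"
proof -
  have "(\<Sum>y\<in>A. f y * h y) = (\<Sum>y\<in>A. (f y - g y) * h y)"
    using assms(5) by (intro sum.cong) (auto simp: algebra_simps)
  moreover have "(\<Sum>y\<in>A. (f y - g y) * h y)\<^sup>2 \<le> (\<Sum>y\<in>A. (f y - g y)\<^sup>2) * (\<Sum>y\<in>A. (h y)\<^sup>2)"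
    by (rule Cauchy_Schwarz_ineq_sum)
  moreover have "\<dots> \<le> a\<^sup>2 * b\<^sup>2"
    using assms by (intro mult_mono) (auto intro: sum_nonneg)
  ultimately have "(\<Sum>y\<in>A. f y * h y)\<^sup>2 \<le> (a * b)\<^sup>2" by (simp add: power_mult_distrib)
  then show ?thesis using assms by (meson mult_nonneg_nonneg power2_le_imp_le)
qed

lemma sum_le_imp_ex_le:
  fixes F :: "'a \<Rightarrow> real"
  assumes "finite S" "real (card S) \<ge> s" "s > 0" "(\<Sum>y\<in>S. F y) \<le> s * b" "b \<ge> 0"
  shows "\<exists>y\<in>S. F y \<le> b"
proof (rule ccontr)
  assume *: "\<not> ?thesis"
  have "S \<noteq> {}" using assms by auto
  then have "(\<Sum>y\<in>S. b) < (\<Sum>y\<in>S. F y)" using * assms by (intro sum_strict_mono) auto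
  moreover have "s * b \<le> (\<Sum>y\<in>S. b)" using assms by (simp add: mult_right_mono)
  ultimately show False using assms by simp
qed

lemma mod5_cancel: "(a + i) mod 5 = (a + j) mod 5 \<longleftrightarrow> i mod 5 = (j :: nat) mod 5" for a :: nat
  using cong_add_lcancel_nat[of a i j 5] by (simp add: cong_def)

text \<open>For a set inside the neighbourhoods of both \<open>w a\<close> and
  \<open>w (a + 2)\<close>, sparseness towards residues at distance two thus reaches every residue
  but one.\<close>

lemma mod5_cases:
  fixes a j :: nat
  assumes "j mod 5 \<noteq> (a + 1) mod 5"
  shows "\<exists>i\<in>{a, a + 2}. j mod 5 = (i + 2) mod 5 \<or> j mod 5 = (i + 3) mod 5"
proof -
  define x m where "x = j mod 5" and "m = a mod 5"
  have "x < 5" "m < 5" by (auto simp: x_def m_def)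
  then have "x \<in> {0, 1, 2, 3, 4}" "m \<in> {0, 1, 2, 3, 4}" by auto
  moreover have "x \<noteq> (m + 1) mod 5" using assms unfolding x_def m_def mod_add_left_eq .
  ultimately have "x = (m + 2) mod 5 \<or> x = (m + 3) mod 5 \<or> x = (m + 4) mod 5 \<or> x = (m + 5) mod 5"
    by (elim insertE emptyE) simp_all
  then show ?thesis unfolding x_def m_def mod_add_left_eq by (simp add: ac_simps)
qed

text \<open>The indices below start at 2, so that \<open>w (i - 2)\<close> is always available for moving an index by a multiple of 5.\<close>

locale dense_walk =
  fixes V :: "'a set" and N :: "'a \<Rightarrow> 'a set" and w :: "nat \<Rightarrow> 'a" and \<kappa> \<theta> :: real
  assumes fin: "finite V"
    and N_sub: "N v \<subseteq> V"
    and sym: "u \<in> N v \<longleftrightarrow> v \<in> N u"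
    and no5: "\<lbrakk>b \<in> N a; c \<in> N b; d \<in> N c; e \<in> N d\<rbrakk> \<Longrightarrow> a \<notin> N e"
    and kappa: "0 < \<kappa>" "\<kappa> < 1"
    and theta: "\<theta> = \<kappa> ^ 3 / 25"
    and degree: "v \<in> V \<Longrightarrow> (1 / 5 + 2 * \<kappa>) * real (card V) \<le> real (card (N v))"
    and walk: "i < 16 \<Longrightarrow> w (Suc i) \<in> N (w i)"
    and periodic: "\<lbrakk>i \<le> 16; j \<le> 16; i mod 5 = j mod 5\<rbrakk> \<Longrightarrow>
      codist V N (w i) (w j) \<le> \<theta>\<^sup>2 * real (card V) ^ 3"
begin

abbreviation n :: real where "n \<equiv> real (card V)"

section \<open>Exactly disjoint neighbourhoods along the walk\<close>

lemma finite_N: "finite (N v)"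
  using fin N_sub finite_subset by blast

lemma card_N_le: "real (card (N v)) \<le> n"
  using card_mono[OF fin N_sub] by simp

lemma symD: "u \<in> N v \<Longrightarrow> v \<in> N u"
  using sym by blast

lemma w_in: "i \<le> 16 \<Longrightarrow> w i \<in> V"
  using walk[of "i - 1"] symD[OF walk[of 0]] N_sub[of "w (i - 1)"] N_sub[of "w 1"] by (cases i) auto

lemma n_pos: "n > 0"
  using w_in[of 0] fin by (auto simp: card_gt_0_iff)

lemma theta_pos: "\<theta> > 0"
  unfolding theta using kappa by simp

text \<open>A common neighbour \<open>x\<close> would give the closed walk
  \<open>v, u, v, u, x\<close>.\<close>

lemma adj_disjoint:
  assumes "u \<in> N v"
  shows "N u \<inter> N v = {}"
proof (rule equals0I)
  fix x assume "x \<in> N u \<inter> N v"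
  then show False using no5[of u v v u x] assms symD[OF assms] symD[of x v] by simp
qed

text \<open>A common neighbour \<open>x\<close> would give the closed walk
  \<open>u, p, q, v, x\<close>.\<close>

lemma dist3_disjoint:
  assumes "p \<in> N u" "q \<in> N p" "v \<in> N q"
  shows "N u \<inter> N v = {}"
proof (rule equals0I)
  fix x assume "x \<in> N u \<inter> N v"
  then show False using no5[of p u q v x] assms symD[of x u] by simp
qed

lemma step1: "i < 16 \<Longrightarrow> N (w i) \<inter> N (w (i + 1)) = {}"
  using adj_disjoint[OF walk[of i]] by (simp add: Int_commute)

lemma step3: "i < 14 \<Longrightarrow> N (w i) \<inter> N (w (i + 3)) = {}"
  using dist3_disjoint[of "w (Suc i)" "w i" "w (Suc (Suc i))" "w (i + 3)"]
    walk[of i] walk[of "Suc i"] walk[of "Suc (Suc i)"]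
  by (simp add: numeral_3_eq_3)

section \<open>Almost periodicity: few edges and few walks of length four\<close>

lemma codist_theta:
  assumes "i \<le> 16" "j \<le> 16" "i mod 5 = j mod 5" "A \<subseteq> V"
  shows "(\<Sum>y\<in>A. (codeg N (w i) y - codeg N (w j) y)\<^sup>2) \<le> (\<theta> * n * sqrt n)\<^sup>2"
proof -
  have "(\<Sum>y\<in>A. (codeg N (w i) y - codeg N (w j) y)\<^sup>2) \<le> codist V N (w i) (w j)"
    unfolding codist_def using fin assms by (intro sum_mono2) auto
  then show ?thesis using periodic[OF assms(1-3)] n_pos
    by (simp add: power_mult_distrib power2_eq_square power3_eq_cube mult_ac)
qed

lemma codeg_zero2: "\<lbrakk>p \<in> N u; v \<in> N p; y \<in> N u\<rbrakk> \<Longrightarrow> codeg N v y = 0"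
  using dist3_disjoint[of u y p v] symD[of y u] by (simp add: codeg_def Int_commute)

text \<open>The sum counts edges between two neighbourhoods. There are none when \<open>w j\<close>
  is replaced by the vertex \<open>w k\<close> exactly two steps away from \<open>w i\<close>, and
  periodicity bounds the error of this replacement.\<close>

lemma edges_small:
  assumes "2 \<le> i" "i \<le> 14" "j \<le> 16" "j mod 5 = (i + 2) mod 5 \<or> j mod 5 = (i + 3) mod 5"
  shows "(\<Sum>y\<in>N (w i). codeg N (w j) y) \<le> \<theta> * n\<^sup>2"
proof -
  obtain k where k: "k \<le> 16" "j mod 5 = k mod 5" "k = i + 2 \<or> k + 2 = i"
  proof (cases "j mod 5 = (i + 2) mod 5")
    case True
    then show ?thesis using that[of "i + 2"] assms by simp
  next
    case False
    moreover have "i + 3 = (i - 2) + 5" using assms by simp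
    ultimately have "j mod 5 = (i - 2) mod 5" using assms(4) by (metis mod_add_self2)
    then show ?thesis using that[of "i - 2"] assms(1-3) le_add_diff_inverse2[OF assms(1)] by simp
  qed
  have "\<exists>p. p \<in> N (w i) \<and> w k \<in> N p"
    using k(3)
  proof
    assume "k = i + 2"
    then show ?thesis using walk[of i] walk[of "Suc i"] assms by auto
  next
    assume "k + 2 = i"
    then show ?thesis using walk[of k] walk[of "Suc k"] assms sym by auto
  qed
  then have z: "codeg N (w k) y * 1 = 0" if "y \<in> N (w i)" for y using codeg_zero2 that by auto
  \<comment> \<open>The weight is constantly 1 on a set of at most n vertices, so its norm is at
    most the root of n.\<close>
  have "(\<Sum>y\<in>N (w i). codeg N (w j) y * 1) \<le> \<theta> * n * sqrt n * sqrt n"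
    by (rule weighted_sum_diff_le[OF codist_theta[OF assms(3) k(1,2) N_sub] _ _ _ z])
      (use card_N_le theta_pos in auto)
  then show ?thesis by (simp add: power2_eq_square mult_ac)
qed

lemma codeg_le: "0 \<le> codeg N u v" "codeg N u v \<le> n"
  using card_mono[of "N u" "N u \<inter> N v"] finite_N card_N_le[of u] by (auto simp: codeg_def)

text \<open>If both factors were nonzero, common neighbours \<open>s\<close> and \<open>t\<close>
  would give the closed walk \<open>u, v, t, y, s\<close>.\<close>

lemma codeg_zero1:
  assumes "v \<in> N u"
  shows "codeg N u y * codeg N v y = 0"
proof (rule ccontr)
  assume "\<not> ?thesis"
  then have "N u \<inter> N y \<noteq> {}" "N v \<inter> N y \<noteq> {}" by (auto simp: codeg_def)
  then obtain s t where "s \<in> N u \<inter> N y" "t \<in> N v \<inter> N y" by blast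
  then show False using no5[of v u t y s] assms symD[of s u] symD[of t y] by simp
qed

text \<open>The sum counts walks of length four from \<open>w j\<close> to \<open>w i\<close> by
  their middle vertex. Adjacent vertices have none, so \<open>w j\<close> is compared with a
  neighbour \<open>w k\<close> of \<open>w i\<close> on the walk.\<close>

lemma paths4_small:
  assumes "1 \<le> i" "i \<le> 15" "j \<le> 16" "j mod 5 = (i + 1) mod 5 \<or> j mod 5 = (i + 4) mod 5"
  shows "(\<Sum>y\<in>V. codeg N (w j) y * codeg N (w i) y) \<le> \<theta> * n ^ 3"
proof -
  obtain k where k: "k \<le> 16" "j mod 5 = k mod 5" "k = i + 1 \<or> k + 1 = i"
  proof (cases "j mod 5 = (i + 1) mod 5")
    case True
    then show ?thesis using that[of "i + 1"] assms by simp
  next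
    case False
    moreover have "i + 4 = (i - 1) + 5" using assms by simp
    ultimately have "j mod 5 = (i - 1) mod 5" using assms(4) by (metis mod_add_self2)
    then show ?thesis using that[of "i - 1"] assms by simp
  qed
  from k(3) have "w i \<in> N (w k)"
  proof (elim disjE)
    assume "k = i + 1"
    then show ?thesis using symD[OF walk[of i]] assms by simp
  next
    assume "k + 1 = i"
    then show ?thesis using walk[of k] assms by auto
  qed
  then have z: "codeg N (w k) y * codeg N (w i) y = 0" for y by (rule codeg_zero1)
  have "(\<Sum>y\<in>V. (codeg N (w i) y)\<^sup>2) \<le> (\<Sum>y\<in>V. n\<^sup>2)"
    using codeg_le by (intro sum_mono power_mono) auto
  also have "\<dots> = (n * sqrt n)\<^sup>2"
    by (simp add: power_mult_distrib power2_eq_square)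
  finally have b: "(\<Sum>y\<in>V. (codeg N (w i) y)\<^sup>2) \<le> (n * sqrt n)\<^sup>2" .
  have "(\<Sum>y\<in>V. codeg N (w j) y * codeg N (w i) y) \<le> \<theta> * n * sqrt n * (n * sqrt n)"
    by (rule weighted_sum_diff_le[OF codist_theta[OF assms(3) k(1,2) subset_refl] b _ _ z])
      (use theta_pos in auto)
  also have "\<dots> = \<theta> * n * n * (sqrt n * sqrt n)" by (simp only: mult_ac)
  also have "\<dots> = \<theta> * n ^ 3" by (simp add: power3_eq_cube)
  finally show ?thesis .
qed

lemma sum_card_swap: "(\<Sum>y\<in>S. real (card (N y \<inter> T))) = (\<Sum>x\<in>V. of_bool (x \<in> T) * real (card (N x \<inter> S)))"
  if "S \<subseteq> V"
proof -
  have S: "finite S" using that fin finite_subset by blast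
  have "(\<Sum>y\<in>S. real (card (N y \<inter> T))) = (\<Sum>y\<in>S. \<Sum>x\<in>V. of_bool (x \<in> N y \<inter> T))"
    using fin N_sub by (intro sum.cong) (auto simp: of_bool_def sum.If_cases intro!: arg_cong[where f = card])
  also have "\<dots> = (\<Sum>x\<in>V. \<Sum>y\<in>S. of_bool (x \<in> N y \<inter> T))" by (rule sum.swap)
  also have "\<dots> = (\<Sum>x\<in>V. of_bool (x \<in> T) * real (card (N x \<inter> S)))"
  proof (rule sum.cong)
    fix x
    have "{y \<in> S. x \<in> N y} = N x \<inter> S" using sym by auto
    then show "(\<Sum>y\<in>S. of_bool (x \<in> N y \<inter> T)) = of_bool (x \<in> T) * real (card (N x \<inter> S))"
      using S by (simp add: of_bool_def sum.If_cases Int_def)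
  qed simp
  finally show ?thesis .
qed

text \<open>By the degree condition and Cauchy-Schwarz, a large common neighbourhood spans many
  walks of length two between its own members. Each of them extends to a walk of length four from
  \<open>w j\<close> to \<open>w i\<close>, against \<open>paths4_small\<close>.\<close>

lemma residue_adjacent_small:
  assumes "1 \<le> i" "i \<le> 15" "j \<le> 16" "j mod 5 = (i + 1) mod 5 \<or> j mod 5 = (i + 4) mod 5"
  shows "real (card (N (w i) \<inter> N (w j))) < \<kappa> * n"
proof -
  let ?S = "N (w i) \<inter> N (w j)"
  have SV: "?S \<subseteq> V" using N_sub by auto
  have "real (card ?S) * (n / 5) = (\<Sum>y\<in>?S. n / 5)" by simp
  also have "\<dots> \<le> (\<Sum>y\<in>?S. real (card (N y \<inter> V)))"
  proof (rule sum_mono)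
    fix y assume "y \<in> ?S"
    then have "y \<in> V" using SV by auto
    from degree[OF this] have "n / 5 + 2 * \<kappa> * n \<le> real (card (N y))" by (simp add: algebra_simps)
    moreover have "2 * \<kappa> * n \<ge> 0" using kappa by simp
    ultimately show "n / 5 \<le> real (card (N y \<inter> V))" using N_sub by (simp add: inf_absorb1)
  qed
  also have "\<dots> = (\<Sum>x\<in>V. real (card (N x \<inter> ?S)))" by (subst sum_card_swap[OF SV]) simp
  finally have "real (card ?S) * (n / 5) \<le> (\<Sum>x\<in>V. real (card (N x \<inter> ?S)) * 1)" by simp
  then have "(real (card ?S) * (n / 5))\<^sup>2 \<le> (\<Sum>x\<in>V. real (card (N x \<inter> ?S)) * 1)\<^sup>2"
    by (intro power_mono) auto
  also have "\<dots> \<le> (\<Sum>x\<in>V. (real (card (N x \<inter> ?S)))\<^sup>2) * (\<Sum>x\<in>V. 1\<^sup>2)"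
    by (rule Cauchy_Schwarz_ineq_sum)
  also have "\<dots> \<le> (\<Sum>x\<in>V. codeg N (w j) x * codeg N (w i) x) * n"
  proof -
    have "(\<Sum>x\<in>V. (real (card (N x \<inter> ?S)))\<^sup>2) \<le> (\<Sum>x\<in>V. codeg N (w j) x * codeg N (w i) x)"
      unfolding power2_eq_square codeg_def
      by (intro sum_mono mult_mono of_nat_mono card_mono) (auto simp: finite_N)
    then show ?thesis by (simp add: mult_right_mono)
  qed
  also have "\<dots> \<le> \<theta> * n ^ 3 * n"
    using paths4_small[OF assms] by (intro mult_right_mono) auto
  \<comment> \<open>The choice of \<theta>: the factor 1 / 25 cancels the squared degree bound, and
    the third power of \<kappa> leaves a spare factor \<kappa> < 1 for strictness.\<close>
  finally have "(real (card ?S))\<^sup>2 * (n\<^sup>2 / 25) \<le> (\<kappa> ^ 3 * n\<^sup>2) * (n\<^sup>2 / 25)"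
    by (simp add: theta power_mult_distrib power_divide power2_eq_square power3_eq_cube mult_ac)
  then have "(real (card ?S))\<^sup>2 \<le> \<kappa> ^ 3 * n\<^sup>2" using n_pos by (simp only: mult_le_cancel_right) auto
  also have "\<dots> < (\<kappa> * n)\<^sup>2"
    using kappa n_pos by (simp add: power_mult_distrib eval_nat_numeral)
  finally show ?thesis
    by (rule power_less_imp_less_base) (use kappa in simp)
qed

section \<open>Typical vertices of large common neighbourhoods\<close>

abbreviation S :: "nat \<Rightarrow> 'a set" where "S a \<equiv> N (w a) \<inter> N (w (a + 2))"
text \<open>Overlaps at index difference two are not controlled by \<open>step1\<close>,
  \<open>step3\<close> or \<open>residue_adjacent_small\<close>. Where such an overlap is large, a
  typical vertex of \<open>S a\<close> can stand in for a walk vertex of residue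
  \<open>a + 1\<close>.\<close>

abbreviation large :: "nat \<Rightarrow> bool" where "large a \<equiv> \<kappa> * n \<le> real (card (S a))"

lemma S_sub: "S a \<subseteq> V" "finite (S a)"
  using N_sub finite_N by auto

text \<open>\<open>S a\<close> lies in both \<open>N (w a)\<close> and \<open>N (w (a + 2))\<close>,
  and by \<open>mod5_cases\<close> one of these has few edges to \<open>N (w j)\<close>.\<close>

lemma S_edges_small:
  assumes "2 \<le> a" "a \<le> 12" "j \<le> 16" "j mod 5 \<noteq> (a + 1) mod 5"
  shows "(\<Sum>y\<in>S a. real (card (N y \<inter> N (w j)))) \<le> \<theta> * n\<^sup>2"
proof -
  from mod5_cases[OF assms(4)] obtain i where i: "i \<in> {a, a + 2}" "j mod 5 = (i + 2) mod 5 \<or> j mod 5 = (i + 3) mod 5" by blast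
  have "(\<Sum>y\<in>S a. real (card (N y \<inter> N (w j)))) \<le> (\<Sum>y\<in>N (w i). codeg N (w j) y)"
    unfolding codeg_def Int_commute[of "N (w j)"] using i(1) finite_N by (intro sum_mono2) auto
  also have "\<dots> \<le> \<theta> * n\<^sup>2" using i assms by (intro edges_small) auto
  finally show ?thesis .
qed

lemma S_edges_sum_small:
  assumes "2 \<le> a" "a \<le> 12" "J \<subseteq> {..16}" "\<And>j. j \<in> J \<Longrightarrow> j mod 5 \<noteq> (a + 1) mod 5" "card J \<le> k"
  shows "(\<Sum>y\<in>S a. \<Sum>j\<in>J. real (card (N y \<inter> N (w j)))) \<le> real k * (\<theta> * n\<^sup>2)"
proof -
  have "(\<Sum>y\<in>S a. \<Sum>j\<in>J. real (card (N y \<inter> N (w j)))) = (\<Sum>j\<in>J. \<Sum>y\<in>S a. real (card (N y \<inter> N (w j))))"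
    by (rule sum.swap)
  also have "\<dots> \<le> (\<Sum>j\<in>J. \<theta> * n\<^sup>2)"
    using assms by (intro sum_mono S_edges_small) auto
  also have "\<dots> \<le> real k * (\<theta> * n\<^sup>2)"
    using assms(5) theta_pos by (simp add: mult_right_mono)
  finally show ?thesis .
qed

text \<open>Averaging: a total of at most 4 \<theta> n ^ 2 over at least \<kappa> n vertices leaves
  some vertex with at most 4 \<kappa> ^ 2 n / 25.\<close>

lemma typical_vertex:
  assumes "2 \<le> a" "a \<le> 12" "large a" "J \<subseteq> {..16}" "\<And>j. j \<in> J \<Longrightarrow> j mod 5 \<noteq> (a + 1) mod 5" "card J \<le> 4"
  obtains y where "y \<in> S a" "\<And>j. j \<in> J \<Longrightarrow> real (card (N y \<inter> N (w j))) < \<kappa> * n"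
proof -
  have finJ: "finite J" using assms finite_subset by blast
  have "\<exists>y\<in>S a. (\<Sum>j\<in>J. real (card (N y \<inter> N (w j)))) \<le> 4 * \<kappa>\<^sup>2 * n / 25"
  proof (rule sum_le_imp_ex_le[OF S_sub(2) assms(3)])
    show "(\<Sum>y\<in>S a. \<Sum>j\<in>J. real (card (N y \<inter> N (w j)))) \<le> \<kappa> * n * (4 * \<kappa>\<^sup>2 * n / 25)"
      using S_edges_sum_small[OF assms(1,2,4,5), of 4] assms(6)
      by (simp add: theta power2_eq_square power3_eq_cube mult_ac)
  qed (use kappa n_pos in auto)
  then obtain y where y: "y \<in> S a" "(\<Sum>j\<in>J. real (card (N y \<inter> N (w j)))) \<le> 4 * \<kappa>\<^sup>2 * n / 25" by blast
  have "4 * \<kappa>\<^sup>2 * n / 25 < \<kappa> * n"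
    using kappa n_pos by (simp add: power2_eq_square)
  then have "real (card (N y \<inter> N (w j))) < \<kappa> * n" if "j \<in> J" for j
    using y(2) member_le_sum[OF that, of "\<lambda>j. real (card (N y \<inter> N (w j)))"] finJ by auto
  then show ?thesis using that y(1) by blast
qed

text \<open>Both sides count walks of length two from \<open>A\<close> to \<open>B\<close>, the
  right one by the middle vertex.\<close>

lemma codegree_sum:
  assumes "A \<subseteq> V" "B \<subseteq> V"
  shows "(\<Sum>y\<in>A. \<Sum>z\<in>B. real (card (N y \<inter> N z))) = (\<Sum>x\<in>V. real (card (N x \<inter> A)) * real (card (N x \<inter> B)))"
proof -
  have finA: "finite A" using assms fin finite_subset by blast
  have "(\<Sum>y\<in>A. \<Sum>z\<in>B. real (card (N y \<inter> N z))) = (\<Sum>y\<in>A. \<Sum>z\<in>B. real (card (N z \<inter> N y)))"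
    by (simp add: Int_commute)
  also have "\<dots> = (\<Sum>y\<in>A. \<Sum>x\<in>V. of_bool (x \<in> N y) * real (card (N x \<inter> B)))"
    using sum_card_swap[OF assms(2)] by simp
  also have "\<dots> = (\<Sum>x\<in>V. \<Sum>y\<in>A. of_bool (x \<in> N y) * real (card (N x \<inter> B)))" by (rule sum.swap)
  also have "\<dots> = (\<Sum>x\<in>V. real (card (N x \<inter> A)) * real (card (N x \<inter> B)))"
  proof (rule sum.cong)
    fix x
    have "{y \<in> A. x \<in> N y} = N x \<inter> A" using sym by auto
    then have "(\<Sum>y\<in>A. of_bool (x \<in> N y)) = real (card (N x \<inter> A))"
      using finA by (simp add: of_bool_def sum.If_cases Int_def)
    then show "(\<Sum>y\<in>A. of_bool (x \<in> N y) * real (card (N x \<inter> B))) = real (card (N x \<inter> A)) * real (card (N x \<inter> B))"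
      by (simp flip: sum_distrib_right)
  qed simp
  finally show ?thesis .
qed

text \<open>Averaging over pairs. Codegrees between \<open>S a\<close> and \<open>S b\<close> are
  small on average because walks of length two between these sets extend to walks of length four
  between \<open>w p\<close> and \<open>w q\<close>, whose residues are consecutive.\<close>

lemma typical_pair:
  assumes ab: "2 \<le> a" "a \<le> 12" "large a" "2 \<le> b" "b \<le> 12" "large b"
    and J: "J \<subseteq> {..16}" "card J \<le> 3"
      "\<And>j. j \<in> J \<Longrightarrow> j mod 5 \<noteq> (a + 1) mod 5" "\<And>j. j \<in> J \<Longrightarrow> j mod 5 \<noteq> (b + 1) mod 5"
    and pq: "p \<in> {a, a + 2}" "q \<in> {b, b + 2}" "q mod 5 = (p + 1) mod 5"
  shows "\<exists>y\<in>S a. \<exists>z\<in>S b. real (card (N y \<inter> N z)) < \<kappa> * n \<and>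
    (\<forall>j\<in>J. real (card (N y \<inter> N (w j))) < \<kappa> * n \<and> real (card (N z \<inter> N (w j))) < \<kappa> * n)"
proof -
  have finJ: "finite J" using J finite_subset by blast
  define F where "F y = (\<Sum>j\<in>J. real (card (N y \<inter> N (w j))))" for y
  have F0: "F y \<ge> 0" for y by (simp add: F_def sum_nonneg)
  have Sn: "real (card (S c)) \<le> n" for c
    using card_mono[OF fin S_sub(1)] by simp
  have F: "(\<Sum>y\<in>S a. F y) \<le> 3 * (\<theta> * n\<^sup>2)" "(\<Sum>z\<in>S b. F z) \<le> 3 * (\<theta> * n\<^sup>2)"
    using S_edges_sum_small[OF ab(1,2) J(1,3,2)] S_edges_sum_small[OF ab(4,5) J(1,4,2)]
    by (auto simp: F_def)
  have "(\<Sum>y\<in>S a. \<Sum>z\<in>S b. real (card (N y \<inter> N z))) = (\<Sum>x\<in>V. real (card (N x \<inter> S a)) * real (card (N x \<inter> S b)))"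
    by (rule codegree_sum[OF S_sub(1) S_sub(1)])
  also have "\<dots> \<le> (\<Sum>x\<in>V. codeg N (w q) x * codeg N (w p) x)"
  proof (rule sum_mono)
    fix x
    have "real (card (N x \<inter> S a)) \<le> codeg N (w p) x" "real (card (N x \<inter> S b)) \<le> codeg N (w q) x"
      unfolding codeg_def using pq by (auto intro!: card_mono simp: finite_N)
    then show "real (card (N x \<inter> S a)) * real (card (N x \<inter> S b)) \<le> codeg N (w q) x * codeg N (w p) x"
      by (subst mult.commute) (intro mult_mono, auto simp: codeg_le)
  qed
  also have "\<dots> \<le> \<theta> * n ^ 3" using pq ab by (intro paths4_small) auto
  finally have P: "(\<Sum>y\<in>S a. \<Sum>z\<in>S b. real (card (N y \<inter> N z))) \<le> \<theta> * n ^ 3" .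
  have "(\<Sum>yz\<in>S a \<times> S b. F (fst yz) + F (snd yz) + real (card (N (fst yz) \<inter> N (snd yz))))
      = (\<Sum>y\<in>S a. \<Sum>z\<in>S b. F y + F z + real (card (N y \<inter> N z)))"
    by (simp add: sum.cartesian_product case_prod_unfold)
  also have "\<dots> = real (card (S b)) * (\<Sum>y\<in>S a. F y) + real (card (S a)) * (\<Sum>z\<in>S b. F z)
      + (\<Sum>y\<in>S a. \<Sum>z\<in>S b. real (card (N y \<inter> N z)))"
    by (simp add: sum.distrib sum_distrib_left)
  \<comment> \<open>The two sums over \<open>J\<close> give 3 \<theta> n ^ 3 each, the codegrees one
    more; 7 \<theta> n ^ 3 spread over at least (\<kappa> n) ^ 2 pairs leaves 7 \<kappa> n /
    25.\<close>
  also have "\<dots> \<le> n * (3 * (\<theta> * n\<^sup>2)) + n * (3 * (\<theta> * n\<^sup>2)) + \<theta> * n ^ 3"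
    using P F Sn F0 theta_pos by (intro add_mono mult_mono) (auto intro: sum_nonneg)
  also have "\<dots> = (\<kappa> * n)\<^sup>2 * (7 * \<kappa> * n / 25)"
    by (simp add: theta power2_eq_square power3_eq_cube)
  finally have tot: "(\<Sum>yz\<in>S a \<times> S b. F (fst yz) + F (snd yz) + real (card (N (fst yz) \<inter> N (snd yz))))
      \<le> (\<kappa> * n)\<^sup>2 * (7 * \<kappa> * n / 25)" .
  have "\<exists>yz\<in>S a \<times> S b. F (fst yz) + F (snd yz) + real (card (N (fst yz) \<inter> N (snd yz))) \<le> 7 * \<kappa> * n / 25"
  proof (rule sum_le_imp_ex_le[OF _ _ _ tot])
    show "(\<kappa> * n)\<^sup>2 \<le> real (card (S a \<times> S b))"
      unfolding card_cartesian_product of_nat_mult power2_eq_square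
      using ab kappa by (intro mult_mono) auto
  qed (use kappa n_pos S_sub in auto)
  then obtain y z where yz: "y \<in> S a" "z \<in> S b" "F y + F z + real (card (N y \<inter> N z)) \<le> 7 * \<kappa> * n / 25"
    by auto
  have lt: "7 * \<kappa> * n / 25 < \<kappa> * n"
    using kappa n_pos by simp
  have le: "real (card (N x \<inter> N (w j))) \<le> F x" if "j \<in> J" for j x
    unfolding F_def using member_le_sum[OF that, of "\<lambda>j. real (card (N x \<inter> N (w j)))"] finJ by auto
  have "real (card (N y \<inter> N (w j))) < \<kappa> * n \<and> real (card (N z \<inter> N (w j))) < \<kappa> * n" if "j \<in> J" for j
    using yz(3) lt F0[of y] F0[of z] le[OF that, of y] le[OF that, of z] by auto
  moreover have "real (card (N y \<inter> N z)) < \<kappa> * n"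
    using yz(3) lt F0[of y] F0[of z] by linarith
  ultimately show ?thesis using yz(1,2) by blast
qed

section \<open>Combinations of five almost disjoint neighbourhoods\<close>

lemma five_neighbourhoods:
  assumes "a \<in> V" "b \<in> V" "c \<in> V" "d \<in> V" "e \<in> V"
    and "real (card (N a \<inter> N b)) < \<kappa> * n" "real (card (N a \<inter> N c)) < \<kappa> * n"
      "real (card (N a \<inter> N d)) < \<kappa> * n" "real (card (N a \<inter> N e)) < \<kappa> * n"
      "real (card (N b \<inter> N c)) < \<kappa> * n" "real (card (N b \<inter> N d)) < \<kappa> * n"
      "real (card (N b \<inter> N e)) < \<kappa> * n" "real (card (N c \<inter> N d)) < \<kappa> * n"
      "real (card (N c \<inter> N e)) < \<kappa> * n" "real (card (N d \<inter> N e)) < \<kappa> * n"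
  shows False
  using fin N_sub N_sub N_sub N_sub N_sub _ _ assms(6-15)
  by (rule no_five_large_sets) (use assms(1-5) degree kappa n_pos in auto)

lemma kn_pos: "0 < \<kappa> * n"
  using kappa n_pos by simp

lemma small1: "\<lbrakk>i < 16; j = i + 1\<rbrakk> \<Longrightarrow> real (card (N (w i) \<inter> N (w j))) < \<kappa> * n"
  using step1[of i] kn_pos by simp

lemma small3: "\<lbrakk>i < 14; j = i + 3\<rbrakk> \<Longrightarrow> real (card (N (w i) \<inter> N (w j))) < \<kappa> * n"
  using step3[of i] kn_pos by simp

lemma small2: "\<lbrakk>\<not> large i; j = i + 2\<rbrakk> \<Longrightarrow> real (card (N (w i) \<inter> N (w j))) < \<kappa> * n"
  by simp

text \<open>Among five consecutive walk vertices, differences 1 and 3 are disjoint and difference 4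
  is an adjacent residue, so one of the three pairs at difference 2 must overlap.\<close>

lemma large_initial: "large 2 \<or> large 3 \<or> large 4"
proof (rule ccontr)
  assume *: "\<not> ?thesis"
  show False
  proof (rule five_neighbourhoods[of "w 2" "w 3" "w 4" "w 5" "w 6"])
    show "real (card (N (w 2) \<inter> N (w 6))) < \<kappa> * n" by (rule residue_adjacent_small) simp_all
  qed (rule w_in small1 small2 small3; use * in simp)+
qed

text \<open>A typical \<open>y\<close> in \<open>S a\<close> stands in for residue
  \<open>a + 1\<close> beside the walk vertices \<open>a + 2\<close> to \<open>a + 5\<close>. Among
  these only two pairs have difference 2, and one of them must overlap.\<close>

lemma large_propagate:
  assumes "2 \<le> a" "a \<le> 10" "large a"
  shows "large (a + 2) \<or> large (a + 3)"
proof (rule ccontr)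
  assume *: "\<not> ?thesis"
  let ?J = "(+) a ` {2, 3, 4, 5}"
  have "j mod 5 \<noteq> (a + 1) mod 5" if "j \<in> ?J" for j
    using that by (elim imageE insertE emptyE; simp only: mod5_cancel) simp_all
  moreover have "card ?J \<le> 4" by (rule order_trans[OF card_image_le]) simp_all
  moreover have "?J \<subseteq> {..16}" "a \<le> 12" using assms by auto
  ultimately obtain y where y: "y \<in> S a"
    "\<And>j. j \<in> ?J \<Longrightarrow> real (card (N y \<inter> N (w j))) < \<kappa> * n"
    using typical_vertex[OF assms(1) _ assms(3), of ?J] by blast
  show False
  proof (rule five_neighbourhoods[of y "w (a + 2)" "w (a + 3)" "w (a + 4)" "w (a + 5)"])
    show "y \<in> V" using y(1) S_sub by auto
    show "real (card (N (w (a + 2)) \<inter> N (w (a + 4)))) < \<kappa> * n"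
      "real (card (N (w (a + 3)) \<inter> N (w (a + 5)))) < \<kappa> * n" by (rule small2; use * in simp)+
  qed (rule y w_in small1 small3; use assms in simp)+
qed

text \<open>\<open>y\<close> and \<open>z\<close> stand in for residues \<open>a + 1\<close> and
  \<open>a + 4\<close>; they fit together because \<open>S a\<close> lies in
  \<open>N (w (a + 2))\<close> and \<open>S (a + 3)\<close> in \<open>N (w (a + 3))\<close>. The
  other residues are taken at indices three apart, whose outer two have adjacent residues.\<close>

lemma not_large_3:
  assumes "2 \<le> a" "a \<le> 6" "large a" "large (a + 3)"
  shows False
proof -
  let ?J = "(+) a ` {2, 5, 8}"
  have "\<exists>y\<in>S a. \<exists>z\<in>S (a + 3). real (card (N y \<inter> N z)) < \<kappa> * n \<and>
    (\<forall>j\<in>?J. real (card (N y \<inter> N (w j))) < \<kappa> * n \<and> real (card (N z \<inter> N (w j))) < \<kappa> * n)"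
  proof (rule typical_pair[where p = "a + 2" and q = "a + 3"])
    show "j mod 5 \<noteq> (a + 1) mod 5" "j mod 5 \<noteq> (a + 3 + 1) mod 5" if "j \<in> ?J" for j
      using that by (elim imageE insertE emptyE; simp only: mod5_cancel add.assoc; simp)+
    show "card ?J \<le> 3" by (rule order_trans[OF card_image_le]) simp_all
    show "(a + 3) mod 5 = (a + 2 + 1) mod 5" by (simp only: mod5_cancel add.assoc) simp
  qed (use assms in auto)
  then obtain y z where yz: "y \<in> S a" "z \<in> S (a + 3)" "real (card (N y \<inter> N z)) < \<kappa> * n"
    "\<And>j. j \<in> ?J \<Longrightarrow> real (card (N y \<inter> N (w j))) < \<kappa> * n"
    "\<And>j. j \<in> ?J \<Longrightarrow> real (card (N z \<inter> N (w j))) < \<kappa> * n" by blast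
  show False
  proof (rule five_neighbourhoods[of y z "w (a + 2)" "w (a + 5)" "w (a + 8)"])
    show "y \<in> V" "z \<in> V" using yz(1,2) N_sub by blast+
    have "(a + 8) mod 5 = (a + 2 + 1) mod 5" by (simp only: mod5_cancel add.assoc) simp
    then show "real (card (N (w (a + 2)) \<inter> N (w (a + 8)))) < \<kappa> * n"
      using assms by (intro residue_adjacent_small disjI1) auto
  qed (rule yz w_in small3; use assms in simp)+
qed

text \<open>Here \<open>z\<close> stands in for residue \<open>a + 5\<close>, and the pair fits
  because \<open>S a\<close> lies in \<open>N (w a)\<close> and \<open>S (a + 4)\<close> in
  \<open>N (w (a + 6))\<close>. The other residues occur at indices with differences 1, 3 and 4
  only.\<close>

lemma not_large_4:
  assumes "2 \<le> a" "a \<le> 6" "large a" "large (a + 4)"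
  shows False
proof -
  let ?J = "(+) a ` {3, 4, 7}"
  have "\<exists>y\<in>S a. \<exists>z\<in>S (a + 4). real (card (N y \<inter> N z)) < \<kappa> * n \<and>
    (\<forall>j\<in>?J. real (card (N y \<inter> N (w j))) < \<kappa> * n \<and> real (card (N z \<inter> N (w j))) < \<kappa> * n)"
  proof (rule typical_pair[where p = a and q = "a + 6"])
    show "j mod 5 \<noteq> (a + 1) mod 5" "j mod 5 \<noteq> (a + 4 + 1) mod 5" if "j \<in> ?J" for j
      using that by (elim imageE insertE emptyE; simp only: mod5_cancel add.assoc; simp)+
    show "card ?J \<le> 3" by (rule order_trans[OF card_image_le]) simp_all
    show "(a + 6) mod 5 = (a + 1) mod 5" by (simp only: mod5_cancel) simp
  qed (use assms in auto)
  then obtain y z where yz: "y \<in> S a" "z \<in> S (a + 4)" "real (card (N y \<inter> N z)) < \<kappa> * n"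
    "\<And>j. j \<in> ?J \<Longrightarrow> real (card (N y \<inter> N (w j))) < \<kappa> * n"
    "\<And>j. j \<in> ?J \<Longrightarrow> real (card (N z \<inter> N (w j))) < \<kappa> * n" by blast
  show False
  proof (rule five_neighbourhoods[of y z "w (a + 3)" "w (a + 4)" "w (a + 7)"])
    show "y \<in> V" "z \<in> V" using yz(1,2) N_sub by blast+
    have "(a + 7) mod 5 = (a + 3 + 4) mod 5" by (simp only: mod5_cancel add.assoc) simp
    then show "real (card (N (w (a + 3)) \<inter> N (w (a + 7)))) < \<kappa> * n"
      using assms by (intro residue_adjacent_small disjI2) auto
  qed (rule yz w_in small1 small3; use assms in simp)+
qed

text \<open>Since overlaps three apart are excluded, propagation must advance by two; two such moves
  reach the excluded distance four.\<close>

lemma contradiction: False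
proof -
  have "\<exists>a\<in>{2, 3, 4}. large a"
    using large_initial by blast
  then obtain a where "a \<in> {2, 3, 4}" and la: "large a" by blast
  then have a: "2 \<le> a" "a \<le> 4" "large a" by auto
  then have le: "a \<le> 10" "a \<le> 6" "2 \<le> a + 2" "a + 2 \<le> 10" "a + 2 \<le> 6" by simp_all
  have "large (a + 2)" using large_propagate[OF a(1) le(1) la] not_large_3[OF a(1) le(2) la] by blast
  then have "large (a + 2 + 2)"
    using large_propagate[OF le(3,4)] not_large_3[OF le(3,5)] by blast
  moreover have "a + 2 + 2 = a + 4" by simp
  ultimately have "large (a + 4)" by metis
  then show False using not_large_4[OF a(1) le(2) la] by blast
qed

end

section \<open>Upper bound\<close>

lemma hom_bounded_above:
  assumes "d > 1 / 5"
  shows "hom_bounded {cycle_graph 3, cycle_graph 5} d"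
proof -
  \<comment> \<open>At most half of the surplus of \<open>d\<close> over 1 / 5, capped to stay below
    1.\<close>
  define \<kappa> where "\<kappa> = min ((d - 1 / 5) / 2) (1 / 2)"
  have kappa: "0 < \<kappa>" "\<kappa> \<le> (d - 1 / 5) / 2" "\<kappa> < 1"
    using assms min.cobounded1[of "(d - 1 / 5) / 2" "1 / 2"] min.cobounded2[of "(d - 1 / 5) / 2" "1 / 2"]
    by (auto simp: \<kappa>_def min_less_iff_disj)
  have kappa_d: "1 / 5 + 2 * \<kappa> \<le> d" using kappa(2) by (simp add: field_simps)
  define \<theta> where "\<theta> = \<kappa> ^ 3 / 25"
  have theta: "\<theta>\<^sup>2 > 0" using kappa by (simp add: \<theta>_def)
  obtain K where K: "\<forall>V (N :: nat \<Rightarrow> nat set). finite V \<longrightarrow> V \<noteq> {} \<longrightarrow> (\<forall>v\<in>V. N v \<subseteq> V) \<longrightarrow>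
    (\<exists>t. \<forall>u\<in>V. t u < (K :: nat) \<and> (\<forall>v\<in>V. t u = t v \<longrightarrow> codist V N u v \<le> \<theta>\<^sup>2 * real (card V) ^ 3))"
    using codist_centers[OF theta] ..
  obtain B where B: "\<forall>V (N :: nat \<Rightarrow> nat set) t. (\<forall>v\<in>V. N v \<subseteq> V) \<longrightarrow> (\<forall>v\<in>V. t v < K) \<longrightarrow>
     (\<forall>v\<in>V. walk_type N t 16 v < (B :: nat))"
    using walk_type_bounded ..
  have "\<exists>H :: nat pair_pre_digraph. pair_graph H \<and> family_free {cycle_graph 3, cycle_graph 5} H \<and>
      card (pverts H) \<le> B \<and> homomorphic_to G H"
    if G: "pair_graph G" "pverts G \<noteq> {}" "family_free {cycle_graph 3, cycle_graph 5} G"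
      and deg: "d * real (card (pverts G)) \<le> real (min_degree G)" for G :: "nat pair_pre_digraph"
  proof -
    interpret pair_graph G by (rule G(1))
    define V N where "V = pverts G" and "N v = {u. (v, u) \<in> parcs G}" for v
    have fin: "finite V" and ne: "V \<noteq> {}" using G(2) by (auto simp: V_def)
    have NV: "N v \<subseteq> V" for v using in_arcsD2 by (auto simp: N_def V_def)
    have finN: "finite (N v)" for v using NV fin finite_subset by blast
    have sym: "u \<in> N v \<longleftrightarrow> v \<in> N u" for u v
      using arcs_symmetric[of u v] arcs_symmetric[of v u] by (auto simp: N_def)
    have free: "closed_walk5_free (parcs G)" by (rule family_free_imp_closed_walk5_free[OF G(1,3)])
    have "\<exists>t. \<forall>u\<in>V. t u < K \<and> (\<forall>v\<in>V. t u = t v \<longrightarrow> codist V N u v \<le> \<theta>\<^sup>2 * real (card V) ^ 3)"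
      by (rule K[THEN spec, THEN spec, THEN mp, THEN mp, THEN mp]) (simp_all add: fin ne NV)
    then obtain t where "\<forall>u\<in>V. t u < K \<and> (\<forall>v\<in>V. t u = t v \<longrightarrow> codist V N u v \<le> \<theta>\<^sup>2 * real (card V) ^ 3)" ..
    then have t: "\<forall>u\<in>V. t u < K"
      "\<And>u v. \<lbrakk>u \<in> V; v \<in> V; t u = t v\<rbrakk> \<Longrightarrow> codist V N u v \<le> \<theta>\<^sup>2 * real (card V) ^ 3" by simp_all
    define T where "T = walk_type N t 16"
    have "\<forall>v\<in>V. walk_type N t 16 v < B"
      by (rule B[THEN spec, THEN spec, THEN spec, THEN mp, THEN mp]) (simp_all add: NV t(1))
    then have TB: "T v < B" if "v \<in> V" for v using that unfolding T_def by simp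
    \<comment> \<open>The quotient of \<open>G\<close> by the final colours. Its size and the
      homomorphism come for free; the work lies in excluding closed 5-walks.\<close>
    define H where "H = \<lparr>pverts = T ` V, parcs = {(T u, T v) |u v. (u, v) \<in> parcs G}\<rparr>"
    have arcsH: "\<exists>u v. v \<in> N u \<and> T u = x \<and> T v = y" if "(x, y) \<in> parcs H" for x y
      using that by (auto simp: H_def N_def)
    have symH: "(y, x) \<in> parcs H" if xy: "(x, y) \<in> parcs H" for x y
    proof -
      obtain u v where "x = T u" "y = T v" "(u, v) \<in> parcs G" using xy by (auto simp: H_def)
      then show ?thesis using arcs_symmetric[of u v] by (auto simp: H_def)
    qed
    have freeH: "closed_walk5_free (parcs H)"
      unfolding closed_walk5_free_def
    proof (intro notI, elim exE conjE)
      fix a b c d' e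
      assume arcs: "(a, b) \<in> parcs H" "(b, c) \<in> parcs H" "(c, d') \<in> parcs H" "(d', e) \<in> parcs H" "(e, a) \<in> parcs H"
      \<comment> \<open>The closed walk read periodically, so that its lift of 16 steps goes more
        than three times around.\<close>
      define h where "h r = [a, b, c, d', e] ! (r mod 5)" for r
      have "(h r, h (Suc r)) \<in> parcs H" for r
      proof -
        have "r mod 5 \<in> {0, 1, 2, 3, 4}" by auto
        then show ?thesis using arcs by (auto simp: h_def mod_Suc)
      qed
      then have edge: "\<exists>u v. v \<in> N u \<and> walk_type N t 16 u = h r \<and> walk_type N t 16 v = h (Suc r)" for r
        using arcsH unfolding T_def by blast
      obtain w where w: "\<And>i. i < 16 \<Longrightarrow> w (Suc i) \<in> N (w i)"
        "\<And>i. i \<le> 16 \<Longrightarrow> \<exists>x. walk_type N t 16 x = h i \<and> walk_type N t (16 - i) (w i) = walk_type N t (16 - i) x"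
        using lift_walk[where j = 16 and L = 16 and N = N and t = t and h = h, OF finN edge] by blast
      \<comment> \<open>After up to 16 steps at least the initial colour is still under control, and
        it is determined by \<open>h i\<close>.\<close>
      have tw: "\<exists>x. walk_type N t 16 x = h i \<and> t (w i) = t x" if i: "i \<le> 16" for i
      proof -
        obtain x where "walk_type N t 16 x = h i" "walk_type N t (16 - i) (w i) = walk_type N t (16 - i) x"
          using w(2)[OF i] by blast
        then show ?thesis using walk_type_antimono[of N t "16 - i" "w i" x 0] finN by auto
      qed
      have wV: "w i \<in> V" if "i \<le> 16" for i
        using w(1)[of "i - 1"] w(1)[of 0] sym[of "w 1" "w 0"] NV that by (cases i) auto
      have "dense_walk V N w \<kappa> \<theta>"
      proof
        show "N v \<subseteq> V" for v by (rule NV)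
        show "u \<in> N v \<longleftrightarrow> v \<in> N u" for u v by (rule sym)
        show "a \<notin> N e" if "b \<in> N a" "c \<in> N b" "d \<in> N c" "e \<in> N d" for a b c d e
          using that closed_walk5_freeD[OF free] by (auto simp: N_def)
        show "(1 / 5 + 2 * \<kappa>) * real (card V) \<le> real (card (N v))" if "v \<in> V" for v
        proof -
          have "min_degree G \<le> card (N v)"
            unfolding min_degree_def N_def out_degree_eq[symmetric]
            using that fin by (intro Min_le) (auto simp: V_def)
          moreover have "(1 / 5 + 2 * \<kappa>) * real (card V) \<le> d * real (card V)"
            using kappa_d by (intro mult_right_mono) auto
          ultimately show ?thesis using deg by (simp add: V_def)
        qed
        show "codist V N (w i) (w j) \<le> \<theta>\<^sup>2 * real (card V) ^ 3"
          if ij: "i \<le> 16" "j \<le> 16" "i mod 5 = j mod 5" for i j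
        proof (rule t(2))
          obtain x y where "walk_type N t 16 x = h i" "t (w i) = t x" "walk_type N t 16 y = h j" "t (w j) = t y"
            using tw[OF ij(1)] tw[OF ij(2)] by blast
          moreover have "h i = h j" using ij by (simp add: h_def)
          ultimately show "t (w i) = t (w j)"
            using walk_type_antimono[of N t 16 x y 0] finN by simp
        qed (use wV that in auto)
      qed (use fin kappa w(1) in \<open>auto simp: \<theta>_def\<close>)
      then show False by (rule dense_walk.contradiction)
    qed
    have "pair_graph H"
    proof (rule pair_graphI)
      show "finite (pverts H)" "parcs H \<subseteq> pverts H \<times> pverts H"
        using fin in_arcsD1 in_arcsD2 by (auto simp: H_def V_def)
      \<comment> \<open>A loop traversed five times is a closed 5-walk.\<close>
      show "(u, u) \<notin> parcs H" for u using closed_walk5_freeD[OF freeH] by blast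
    qed (rule symH)
    moreover have "family_free {cycle_graph 3, cycle_graph 5} H"
      using freeH symH by (rule closed_walk5_free_imp_family_free)
    moreover have "card (pverts H) \<le> B"
      using TB card_mono[of "{..<B}" "pverts H"] by (auto simp: H_def)
    moreover have "homomorphic_to G H"
      unfolding homomorphic_to_def graph_hom_def by (rule exI[of _ T]) (auto simp: H_def V_def)
    ultimately show ?thesis by blast
  qed
  then show ?thesis unfolding hom_bounded_def by blast
qed

section \<open>Lower bound\<close>

text \<open>
  \<open>Top 2 i i\<close> is \<open>w\<^sub>i\<close>, and the path from \<open>w\<^sub>i\<close> to \<open>w\<^sub>j\<close> for \<open>i < j\<close> has the inner vertices \<open>Top c i j\<close> with
  \<open>c = 1, 0, 4, 3\<close> in this order. \<open>Bot c k\<close> is the \<open>k\<close>-th vertex of the large class below column \<open>c\<close>.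
\<close>

datatype ladder_vertex = Top nat nat nat | Bot nat nat

text \<open>Provides \<open>to_nat\<close>, which moves the ladder to the vertex type fixed in
  \<open>hom_bounded\<close>.\<close>

instance ladder_vertex :: countable
  by countable_datatype

fun ladder_arc :: "ladder_vertex \<Rightarrow> ladder_vertex \<Rightarrow> bool" where
  "ladder_arc (Top c i j) (Top c' i' j') \<longleftrightarrow>
     c = 2 \<and> c' = 1 \<and> i' = i \<or> (c, c') \<in> {(1, 0), (0, 4), (4, 3)} \<and> i' = i \<and> j' = j \<or>
     c = 3 \<and> c' = 2 \<and> j' = j"
| "ladder_arc (Bot c k) (Bot c' k') \<longleftrightarrow> c' = Suc c"
| "ladder_arc (Top c i j) (Bot c' k) \<longleftrightarrow> c' = c"
| "ladder_arc (Bot c' k) (Top c i j) \<longleftrightarrow> False"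

definition ladder_verts :: "nat \<Rightarrow> nat \<Rightarrow> ladder_vertex set" where
  "ladder_verts n m = {Top 2 i i |i. i < n} \<union> {Top c i j |c i j. c \<in> {0, 1, 3, 4} \<and> i < j \<and> j < n} \<union>
     {Bot c k |c k. c < 5 \<and> k < m}"

definition ladder_rel :: "nat \<Rightarrow> nat \<Rightarrow> ladder_vertex rel" where
  "ladder_rel n m = {(x, y). x \<in> ladder_verts n m \<and> y \<in> ladder_verts n m \<and> (ladder_arc x y \<or> ladder_arc y x)}"

text \<open>The edges across the cut opposite to column 2; they exist in the top row only.\<close>

fun wrap :: "ladder_vertex \<Rightarrow> ladder_vertex \<Rightarrow> bool" where
  "wrap (Top c i j) (Top c' i' j') \<longleftrightarrow> c = 0 \<and> c' = 4 \<or> c = 4 \<and> c' = 0"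
| "wrap _ _ \<longleftrightarrow> False"

text \<open>Deleting the edges with \<open>wrap\<close> makes the graph bipartite.\<close>

fun side :: "ladder_vertex \<Rightarrow> bool" where
  "side (Top c i j) \<longleftrightarrow> even c"
| "side (Bot c k) \<longleftrightarrow> odd c"

section \<open>Absence of closed 5-walks in the ladder\<close>

lemma ladder_rel_sym: "(x, y) \<in> ladder_rel n m \<Longrightarrow> (y, x) \<in> ladder_rel n m"
  by (auto simp: ladder_rel_def)

lemma side_flip: "(x, y) \<in> ladder_rel n m \<Longrightarrow> \<not> wrap x y \<Longrightarrow> side x \<noteq> side y"
  by (cases x; cases y) (auto simp: ladder_rel_def)

lemma Top2_verts: "Top 2 i j \<in> ladder_verts n m \<Longrightarrow> i = j"
  by (auto simp: ladder_verts_def)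

text \<open>Both ends of the edge across the cut carry the same indices \<open>i < j\<close>. The
  only way to close up in four further steps is round the top through \<open>Top 2 i j\<close>,
  which would force \<open>i = j\<close>.\<close>

lemma no_return_of_wrap:
  assumes "(Top 0 i j, Top 4 i' j') \<in> ladder_rel n m" "(Top 4 i' j', x) \<in> ladder_rel n m"
    "(x, y) \<in> ladder_rel n m" "(y, z) \<in> ladder_rel n m" "(z, Top 0 i j) \<in> ladder_rel n m"
  shows False
proof -
  have ij: "i' = i" "j' = j" "i < j" using assms(1) by (auto simp: ladder_rel_def ladder_verts_def)
  have x: "x = Top 3 i j \<or> x = Top 0 i j \<or> (\<exists>k. x = Bot 4 k)"
    using assms(2) ij by (cases x) (auto simp: ladder_rel_def)
  have z: "z = Top 1 i j \<or> z = Top 4 i j \<or> (\<exists>k. z = Bot 0 k)"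
    using assms(5) by (cases z) (auto simp: ladder_rel_def)
  show False
    using x z
  proof (elim disjE exE)
    assume xz: "x = Top 3 i j" "z = Top 1 i j"
    then have "y = Top 2 i j" using assms(3,4) by (cases y) (auto simp: ladder_rel_def)
    then have "Top 2 i j \<in> ladder_verts n m" using assms(3) by (simp add: ladder_rel_def)
    then show False using Top2_verts ij(3) by blast
  qed (use assms(3,4) in \<open>cases y; simp add: ladder_rel_def; fastforce\<close>)+
qed

text \<open>An odd closed walk must use an edge with \<open>wrap\<close>, as all other edges change
  the side. Rotating the walk puts that edge first.\<close>

lemma closed_walk5_free_ladder: "closed_walk5_free (ladder_rel n m)"
proof -
  have no_wrap: False if w: "(a, b) \<in> ladder_rel n m" "(b, c) \<in> ladder_rel n m" "(c, d) \<in> ladder_rel n m"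
    "(d, e) \<in> ladder_rel n m" "(e, a) \<in> ladder_rel n m" "wrap a b" for a b c d e
  proof -
    have "(\<exists>i j i' j'. a = Top 0 i j \<and> b = Top 4 i' j') \<or> (\<exists>i j i' j'. b = Top 0 i j \<and> a = Top 4 i' j')"
      using w(6) by (cases a; cases b) auto
    then show False
    proof (elim disjE exE conjE)
      fix i j i' j' assume "a = Top 0 i j" "b = Top 4 i' j'"
      then show False using no_return_of_wrap[of i j i' j' n m c d e] w(1-5) by simp
    next
      \<comment> \<open>The edge is crossed in the other direction; reversing the walk restores the
        previous case.\<close>
      fix i j i' j' assume "b = Top 0 i j" "a = Top 4 i' j'"
      then show False using no_return_of_wrap[of i j i' j' n m e d c] w(1-5)[THEN ladder_rel_sym] by simp
    qed
  qed
  show ?thesis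
    unfolding closed_walk5_free_def
  proof (intro notI, elim exE conjE)
    fix a b c d e
    assume w: "(a, b) \<in> ladder_rel n m" "(b, c) \<in> ladder_rel n m" "(c, d) \<in> ladder_rel n m"
      "(d, e) \<in> ladder_rel n m" "(e, a) \<in> ladder_rel n m"
    have "\<not> wrap a b" "\<not> wrap b c" "\<not> wrap c d" "\<not> wrap d e" "\<not> wrap e a"
      using no_wrap[of a b c d e] no_wrap[of b c d e a] no_wrap[of c d e a b] no_wrap[of d e a b c]
        no_wrap[of e a b c d] w by auto
    then show False using w[THEN side_flip] by auto
  qed
qed

section \<open>Size and degrees of the ladder\<close>

lemma finite_ladder_verts: "finite (ladder_verts n m)"
  and card_ladder_verts: "card (ladder_verts n m) \<le> 5 * n * n + 5 * m"
proof -
  define X where "X = (\<lambda>(c, i, j). Top c i j) ` ({..<5} \<times> {..<n} \<times> {..<n})"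
  define Y where "Y = (\<lambda>(c, k). Bot c k) ` ({..<5} \<times> {..<m})"
  have sub: "ladder_verts n m \<subseteq> X \<union> Y"
    by (auto simp: ladder_verts_def X_def Y_def image_iff)
  have fin: "finite (X \<union> Y)" by (simp add: X_def Y_def)
  show "finite (ladder_verts n m)" using sub fin by (rule finite_subset)
  have "card (ladder_verts n m) \<le> card (X \<union> Y)" using fin sub by (rule card_mono)
  also have "\<dots> \<le> card X + card Y" by (rule card_Un_le)
  also have "card X \<le> 5 * n * n"
    unfolding X_def by (rule order_trans[OF card_image_le]) (auto simp: card_cartesian_product)
  also have "card Y \<le> 5 * m"
    unfolding Y_def by (rule order_trans[OF card_image_le]) (auto simp: card_cartesian_product)
  finally show "card (ladder_verts n m) \<le> 5 * n * n + 5 * m" by simp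
qed

text \<open>Every vertex is joined to an entire bottom class: a top vertex to the one below it, a
  bottom vertex to the one in a neighbouring column.\<close>

lemma ladder_degree:
  assumes "x \<in> ladder_verts n m"
  shows "m \<le> card {y. (x, y) \<in> ladder_rel n m}"
proof -
  have "\<exists>c. c < 5 \<and> (\<forall>k<m. (x, Bot c k) \<in> ladder_rel n m)"
  proof (cases x)
    case (Top c i j)
    then show ?thesis using assms
      by (intro exI[of _ c]) (auto simp: ladder_rel_def ladder_verts_def)
  next
    case (Bot c k)
    then show ?thesis using assms
      by (intro exI[of _ "if c = 0 then 1 else c - 1"]) (auto simp: ladder_rel_def ladder_verts_def)
  qed
  then obtain c where "\<forall>k<m. (x, Bot c k) \<in> ladder_rel n m" by blast
  then have "Bot c ` {..<m} \<subseteq> {y. (x, y) \<in> ladder_rel n m}" by auto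
  moreover have "finite {y. (x, y) \<in> ladder_rel n m}"
    by (rule finite_subset[OF _ finite_ladder_verts[of n m]]) (auto simp: ladder_rel_def)
  ultimately have "card (Bot c ` {..<m}) \<le> card {y. (x, y) \<in> ladder_rel n m}" by (intro card_mono)
  then show ?thesis by (simp add: card_image inj_on_def)
qed

text \<open>Identifying two of the \<open>n\<close> vertices in column 2 would close the image of
  the path between them to a 5-walk, so every admissible image has at least \<open>n\<close>
  vertices, whatever the bound \<open>C\<close>.\<close>

lemma not_hom_bounded_below:
  assumes "d < 1 / 5"
  shows "\<not> hom_bounded {cycle_graph 3, cycle_graph 5} d"
proof
  assume "hom_bounded {cycle_graph 3, cycle_graph 5} d"
  then obtain C where C: "\<And>G :: nat pair_pre_digraph.
    \<lbrakk>pair_graph G; pverts G \<noteq> {}; family_free {cycle_graph 3, cycle_graph 5} G;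
      d * real (card (pverts G)) \<le> real (min_degree G)\<rbrakk> \<Longrightarrow>
      \<exists>H :: nat pair_pre_digraph. pair_graph H \<and> family_free {cycle_graph 3, cycle_graph 5} H \<and>
        card (pverts H) \<le> C \<and> homomorphic_to G H"
    unfolding hom_bounded_def by blast
  define n where "n = Suc C"
  \<comment> \<open>Solves \<open>d * (5 * n * n + 5 * m) \<le> m\<close> for \<open>m\<close>; the
    absolute value also covers negative \<open>d\<close>.\<close>
  obtain m :: nat where m: "\<bar>d\<bar> * real (5 * n * n) / (1 - 5 * d) < real m"
    using reals_Archimedean2 by blast
  define V where "V = ladder_verts n m"
  define R where "R = ladder_rel n m"
  define G :: "nat pair_pre_digraph" where
    "G = \<lparr>pverts = to_nat ` V, parcs = (\<lambda>(x, y). (to_nat x, to_nat y)) ` R\<rparr>"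
  have RV: "R \<subseteq> V \<times> V" by (auto simp: R_def V_def ladder_rel_def)
  have symR: "(y, x) \<in> R" if "(x, y) \<in> R" for x y using that ladder_rel_sym by (simp add: R_def)
  have freeR: "closed_walk5_free R" unfolding R_def by (rule closed_walk5_free_ladder)
  have arcG: "(u, v) \<in> parcs G \<longleftrightarrow> (\<exists>x y. u = to_nat x \<and> v = to_nat y \<and> (x, y) \<in> R)" for u v
    by (auto simp: G_def)
  have cardG: "card (pverts G) = card V" by (simp add: G_def card_image)
  have symG: "(v, u) \<in> parcs G" if "(u, v) \<in> parcs G" for u v
    using that symR unfolding arcG by blast
  have decode: "(from_nat u, from_nat v) \<in> R" if "(u, v) \<in> parcs G" for u v
    using that by (auto simp: arcG)
  have freeG: "closed_walk5_free (parcs G)"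
    unfolding closed_walk5_free_def
  proof (intro notI, elim exE conjE)
    fix a b c d e
    assume "(a, b) \<in> parcs G" "(b, c) \<in> parcs G" "(c, d) \<in> parcs G" "(d, e) \<in> parcs G" "(e, a) \<in> parcs G"
    then show False using decode closed_walk5_freeD[OF freeR] by blast
  qed
  have pgG: "pair_graph G"
  proof (rule pair_graphI)
    show "finite (pverts G)" by (simp add: G_def V_def finite_ladder_verts)
    show "parcs G \<subseteq> pverts G \<times> pverts G" using RV by (auto simp: G_def)
    show "(u, u) \<notin> parcs G" for u using closed_walk5_freeD[OF freeG] by blast
  qed (rule symG)
  have W: "Top 2 i i \<in> V" if "i < n" for i using that by (auto simp: V_def ladder_verts_def)
  have neG: "pverts G \<noteq> {}" using W[of 0] by (auto simp: G_def n_def)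
  have "m \<le> out_degree (with_proj G) v" if v: "v \<in> pverts G" for v
  proof -
    obtain x where x: "x \<in> V" "v = to_nat x" using v by (auto simp: G_def)
    have "{u. (v, u) \<in> parcs G} = to_nat ` {y. (x, y) \<in> R}"
      unfolding x(2) arcG by auto
    then have "out_degree (with_proj G) v = card {y. (x, y) \<in> R}"
      by (simp add: out_degree_eq card_image)
    then show ?thesis using ladder_degree x(1) by (simp add: V_def R_def)
  qed
  then have "m \<le> min_degree G"
    unfolding min_degree_def using neG pgG
    by (subst Min_ge_iff) (auto simp: G_def V_def finite_ladder_verts)
  moreover have "d * real (card (pverts G)) \<le> real m"
  proof -
    have "d * real (card V) \<le> \<bar>d\<bar> * real (5 * n * n) + 5 * d * real m"
    proof (cases "d \<ge> 0")
      case True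
      have "real (card V) \<le> real (5 * n * n + 5 * m)"
        unfolding V_def by (intro of_nat_mono card_ladder_verts)
      from mult_left_mono[OF this True] show ?thesis using True by (simp add: algebra_simps)
    next
      \<comment> \<open>For negative \<open>d\<close> a lower bound on the number of vertices is
        required, namely the size of the bottom row.\<close>
      case False
      have "5 * m \<le> card V"
      proof -
        have "(\<lambda>(c, k). Bot c k) ` ({..<5} \<times> {..<m}) \<subseteq> V" by (auto simp: V_def ladder_verts_def)
        then have "card ((\<lambda>(c, k). Bot c k) ` ({..<5 :: nat} \<times> {..<m})) \<le> card V"
          by (intro card_mono) (auto simp: V_def finite_ladder_verts)
        then show ?thesis by (simp add: card_image inj_on_def card_cartesian_product)
      qed
      then have "real (5 * m) \<le> real (card V)" by (rule of_nat_mono)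
      from mult_left_mono_neg[OF this, of d] False have "d * real (card V) \<le> 5 * d * real m" by simp
      also have "\<dots> \<le> \<bar>d\<bar> * real (5 * n * n) + 5 * d * real m" by simp
      finally show ?thesis .
    qed
    also have "\<bar>d\<bar> * real (5 * n * n) < real m * (1 - 5 * d)"
      using m assms by (simp add: pos_divide_less_eq)
    finally show ?thesis by (simp add: cardG algebra_simps)
  qed
  moreover have "family_free {cycle_graph 3, cycle_graph 5} G"
    using freeG symG by (rule closed_walk5_free_imp_family_free)
  ultimately obtain H :: "nat pair_pre_digraph" where H: "pair_graph H"
    "family_free {cycle_graph 3, cycle_graph 5} H" "card (pverts H) \<le> C" "homomorphic_to G H"
    using C[OF pgG neG] by fastforce
  interpret H: pair_graph H by (rule H(1))
  have freeH: "closed_walk5_free (parcs H)" by (rule family_free_imp_closed_walk5_free[OF H(1,2)])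
  obtain f where f: "graph_hom f G H" using H(4) by (auto simp: homomorphic_to_def)
  define g where "g x = f (to_nat x)" for x :: ladder_vertex
  have g: "(g x, g y) \<in> parcs H" if "(x, y) \<in> R" for x y
    using f that unfolding graph_hom_def g_def G_def by fastforce
  have gne: "g (Top 2 i i) \<noteq> g (Top 2 j j)" if "i < j" "j < n" for i j
  proof
    assume eq: "g (Top 2 i i) = g (Top 2 j j)"
    have "(Top 2 i i, Top 1 i j) \<in> R" "(Top 1 i j, Top 0 i j) \<in> R" "(Top 0 i j, Top 4 i j) \<in> R"
      "(Top 4 i j, Top 3 i j) \<in> R" "(Top 3 i j, Top 2 j j) \<in> R"
      using that by (auto simp: R_def ladder_rel_def ladder_verts_def)
    then show False using closed_walk5_freeD[OF freeH] g eq by metis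
  qed
  have "inj_on (\<lambda>i. g (Top 2 i i)) {..<n}"
    by (rule linorder_inj_onI) (use gne in auto)
  moreover have "(\<lambda>i. g (Top 2 i i)) ` {..<n} \<subseteq> pverts H"
    using f W unfolding graph_hom_def g_def G_def by auto
  ultimately have "n \<le> card (pverts H)"
    using card_inj_on_le[of "\<lambda>i. g (Top 2 i i)" "{..<n}" "pverts H"] H.pair_finite_verts by simp
  then show False using H(3) by (simp add: n_def)
qed

theorem theorem1p1:
  shows "hom_threshold {cycle_graph 3, cycle_graph 5} = 1 / 5"
  unfolding hom_threshold_def
proof (rule cInf_eq_non_empty)
  show "{d. 0 \<le> d \<and> d \<le> 1 \<and> hom_bounded {cycle_graph 3, cycle_graph 5} d} \<noteq> {}"
    using hom_bounded_above[of 1] by auto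
  show "1 / 5 \<le> d" if "d \<in> {d. 0 \<le> d \<and> d \<le> 1 \<and> hom_bounded {cycle_graph 3, cycle_graph 5} d}" for d
    using that not_hom_bounded_below[of d] by force
  show "y \<le> 1 / 5" if y: "\<And>d. d \<in> {d. 0 \<le> d \<and> d \<le> 1 \<and> hom_bounded {cycle_graph 3, cycle_graph 5} d} \<Longrightarrow> y \<le> d" for y
  proof (rule ccontr)
    assume "\<not> ?thesis"
    \<comment> \<open>A point strictly between 1 / 5 and \<open>y\<close>, or 1 if that is smaller,
      to stay inside the admissible range.\<close>
    moreover define d where "d = min ((y + 1 / 5) / 2) 1"
    ultimately have "1 / 5 < d" "d \<le> 1" "d < y" by (auto simp: min_def field_simps)
    then show False using y[of d] hom_bounded_above[of d] by simp
  qed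
qed

end
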